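(* Let $W$ be a standard Brownian motion and let $S$ be a random walk with 1-subgaussian increments, i.e. $S_n=\sum_{i=1}^n X_i$, $S_0=0$, with $X_1,X_2,\dots$ i.i.d. 1-subgaussian random variables. For $t>0$ and $x\in\mathbb{R}$ let $$V^{S}(t,x)=\sup_{\tau}\mathbb{E}\left[\frac{x+S_\tau}{t+\tau}\right],\qquad V^{W}(t,x)=\sup_{\tau}\mathbb{E}\left[\frac{x+W_\tau}{t+\tau}\right].$$ Then $$V^{W}(t,x)\ge V^{S}(t,x)\qquad\text{for all } t>0,\ x\in\mathbb{R}.$$
   Context: A real, centered random variable $\xi$ is called 1-subgaussian if $\mathbb{E}[e^{a\xi}]\le e^{a^2/2}$ for all $a\in\mathbb{R}$. In the definition of $V^S$ the supremum is over all a.s. finite stopping times $\tau$ with values in $\{0,1,2,\dots\}$ with respect to the natural filtration of $S$; in the definition of $V^W$ it is over all a.s. finite stopping times $\tau$ with values in $[0,\infty)$ with respect to the filtration of $W$ (with $W_0=0$). *)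

theory Defs
  imports "HOL-Probability.Probability"
begin

text \<open>The exponential moments are taken as nonnegative Lebesgue integrals, so that the bound
  includes their finiteness (a Bochner integral would be \<open>0\<close> if they diverged).\<close>

definition subgaussian1 :: "'a measure \<Rightarrow> ('a \<Rightarrow> real) \<Rightarrow> bool" where
  "subgaussian1 M \<xi> \<longleftrightarrow>
     integrable M \<xi> \<and> (\<integral>\<omega>. \<xi> \<omega> \<partial>M) = 0 \<and>
     (\<forall>a::real. (\<integral>\<^sup>+\<omega>. ennreal (exp (a * \<xi> \<omega>)) \<partial>M) \<le> ennreal (exp (a\<^sup>2 / 2)))"

definition partial_sum :: "(nat \<Rightarrow> 'a \<Rightarrow> real) \<Rightarrow> nat \<Rightarrow> 'a \<Rightarrow> real" where
  "partial_sum X n \<omega> = (\<Sum>i=1..n. X i \<omega>)"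

text \<open>Only the values \<open>W t\<close> with \<open>t \<ge> 0\<close> matter. All paths are continuous and start at \<open>0\<close>.\<close>

definition standard_brownian_motion :: "'a measure \<Rightarrow> (real \<Rightarrow> 'a \<Rightarrow> real) \<Rightarrow> bool" where
  "standard_brownian_motion M W \<longleftrightarrow>
     prob_space M \<and>
     (\<forall>t\<ge>0. W t \<in> borel_measurable M) \<and>
     (\<forall>\<omega>\<in>space M. W 0 \<omega> = 0) \<and>
     (\<forall>\<omega>\<in>space M. continuous_on {0..} (\<lambda>t. W t \<omega>)) \<and>
     (\<forall>(n::nat) (u::nat \<Rightarrow> real). 0 \<le> u 0 \<and> strict_mono_on {..n} u \<longrightarrow>
        prob_space.indep_vars M (\<lambda>_. borel) (\<lambda>i \<omega>. W (u (Suc i)) \<omega> - W (u i) \<omega>) {..<n}) \<and>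
     (\<forall>s t. 0 \<le> s \<and> s < t \<longrightarrow>
        distributed M lborel (\<lambda>\<omega>. W t \<omega> - W s \<omega>) (\<lambda>x. ennreal (normal_density 0 (sqrt (t - s)) x)))"

text \<open>The sigma-algebras generated by a process \<open>Z\<close> with time set \<open>I\<close>. The map \<open>\<iota>\<close> embeds \<open>I\<close> into
  a time axis which also contains \<open>\<infinity>\<close>, so that stopping times, whose values have the index
  type of the filtration, may be infinite.\<close>

definition natural_filtration ::
    "'a measure \<Rightarrow> 'i set \<Rightarrow> ('i \<Rightarrow> 't::linorder) \<Rightarrow> ('i \<Rightarrow> 'a \<Rightarrow> real) \<Rightarrow> 't \<Rightarrow> 'a measure" where
  "natural_filtration M I \<iota> Z t =
     sigma (space M) {Z i -` A \<inter> space M | i A. i \<in> I \<and> \<iota> i \<le> t \<and> A \<in> sets borel}"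

lemma filtration_natural_filtration:
  fixes \<iota> :: "'i \<Rightarrow> 't::{linorder_topology, second_countable_topology}"
  shows "filtration (space M) (natural_filtration M I \<iota> Z)"
proof
  show "space (natural_filtration M I \<iota> Z t) = space M" for t
    unfolding natural_filtration_def by (rule space_measure_of) auto
  show "sets (natural_filtration M I \<iota> Z s) \<subseteq> sets (natural_filtration M I \<iota> Z t)"
    if "s \<le> t" for s t
  proof -
    have "{Z i -` A \<inter> space M | i A. i \<in> I \<and> \<iota> i \<le> s \<and> A \<in> sets borel}
        \<subseteq> {Z i -` A \<inter> space M | i A. i \<in> I \<and> \<iota> i \<le> t \<and> A \<in> sets borel}"
      using that by (blast intro: order_trans)
    then show ?thesis
      unfolding natural_filtration_def
      by (subst (1 2) sets_measure_of) (auto intro!: sigma_sets_mono')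
  qed
qed

text \<open>The suprema are taken in \<^typ>\<open>ereal\<close>, so they need no boundedness assumption. The values
  of \<^const>\<open>the_enat\<close> and \<^const>\<open>enn2real\<close> at \<open>\<infinity>\<close> only enter on a null set, as the stopping
  times are almost surely finite.\<close>

definition V_walk :: "'a measure \<Rightarrow> (nat \<Rightarrow> 'a \<Rightarrow> real) \<Rightarrow> real \<Rightarrow> real \<Rightarrow> ereal" where
  "V_walk M S t x =
     (SUP \<tau> \<in> {\<tau>. stopping_time (natural_filtration M UNIV enat S) \<tau> \<and> (AE \<omega> in M. \<tau> \<omega> < \<infinity>)}.
        ereal (\<integral>\<omega>. (x + S (the_enat (\<tau> \<omega>)) \<omega>) / (t + real (the_enat (\<tau> \<omega>))) \<partial>M))"

definition V_brownian :: "'a measure \<Rightarrow> (real \<Rightarrow> 'a \<Rightarrow> real) \<Rightarrow> real \<Rightarrow> real \<Rightarrow> ereal" where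
  "V_brownian M W t x =
     (SUP \<tau> \<in> {\<tau>. stopping_time (natural_filtration M {0..} ennreal W) \<tau> \<and> (AE \<omega> in M. \<tau> \<omega> < \<infinity>)}.
        ereal (\<integral>\<omega>. (x + W (enn2real (\<tau> \<omega>)) \<omega>) / (t + enn2real (\<tau> \<omega>)) \<partial>M))"

end

theory Submission
  imports Defs "HOL-Real_Asymp.Real_Asymp"
begin

text \<open>Let \<open>\<phi> t y = (1 - \<alpha>\<^sup>2) * (\<integral>l. exp (l * y - l\<^sup>2 * t / 2))\<close>, integrated over \<open>l \<ge> 0\<close>, where \<open>\<alpha>\<close> is
  chosen such that \<open>\<phi> t (\<alpha> * sqrt t) = \<alpha> / sqrt t\<close>. By convexity and smooth fit, \<open>y / t \<le> \<phi> t y\<close>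
  everywhere. As a mixture of exponentials, \<open>\<phi>\<close> is a supermartingale along the subgaussian walk and
  a martingale along Brownian motion. Hence the walk cannot gain more than \<open>\<phi> t x\<close>, whereas
  Brownian motion started below the boundary \<open>\<alpha> * sqrt t\<close> attains \<open>\<phi> t x\<close> by stopping at the
  boundary. If \<open>x\<close> lies above the boundary, comparing the payoffs from \<open>x\<close> and from the boundary
  point \<open>\<alpha> * sqrt t\<close> shows that the walk cannot beat \<open>x / t\<close>, the payoff of immediate stopping.

  Stopping at the boundary is realised by the first crossing time on a dyadic grid, truncated at
  \<open>m\<close>. These times decrease, as the grid is refined, to a time at which the path is not above the
  boundary; this suffices for a lower bound whose error vanishes as \<open>m\<close> tends to infinity, and it
  avoids stopping theorems in continuous time and the finiteness of the hitting time.\<close>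

section \<open>Stopped products of independent variables\<close>

lemma (in prob_space) indep_var_nn_integral_mult:
  fixes U V :: "'a \<Rightarrow> real"
  assumes "indep_var borel U borel V" "\<And>\<omega>. 0 \<le> U \<omega>" "\<And>\<omega>. 0 \<le> V \<omega>"
  shows "(\<integral>\<^sup>+\<omega>. ennreal (U \<omega> * V \<omega>) \<partial>M) = (\<integral>\<^sup>+\<omega>. ennreal (U \<omega>) \<partial>M) * (\<integral>\<^sup>+\<omega>. ennreal (V \<omega>) \<partial>M)"
proof -
  have eq: "case_bool borel borel = (\<lambda>_. borel :: real measure)"
    by (auto simp: fun_eq_iff split: bool.split)
  have "(\<integral>\<^sup>+\<omega>. (\<Prod>i\<in>UNIV. ennreal (case_bool U V i \<omega>)) \<partial>M)
      = (\<Prod>i\<in>UNIV. \<integral>\<^sup>+\<omega>. ennreal (case_bool U V i \<omega>) \<partial>M)"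
    using assms(2,3)
    by (intro indep_vars_nn_integral indep_vars_compose2[OF assms(1)[unfolded indep_var_def eq]])
       (auto split: bool.split)
  then show ?thesis
    using assms(2,3) by (simp add: UNIV_bool mult.commute ennreal_mult)
qed

text \<open>Singleton blocks in \<open>indep_vars_restrict\<close> turn the index set
  \<open>{1..}\<close> of the increments into all of \<open>nat\<close>, so that products over
  \<open>{..<k}\<close> can be used for the walk and for Brownian motion alike.\<close>

lemma (in prob_space) indep_vars_nat_shift:
  assumes "indep_vars (\<lambda>_. borel) X {1..}"
  shows "indep_vars (\<lambda>_. borel) (\<lambda>i. X (Suc i)) (UNIV :: nat set)"
proof -
  have "indep_vars (\<lambda>j. PiM {Suc j} (\<lambda>_. borel)) (\<lambda>j \<omega>. restrict (\<lambda>i. X i \<omega>) {Suc j}) UNIV"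
    by (rule indep_vars_restrict[OF assms]) (auto simp: disjoint_family_on_def)
  then have "indep_vars (\<lambda>_. borel) (\<lambda>j \<omega>. (\<lambda>f. f (Suc j)) (restrict (\<lambda>i. X i \<omega>) {Suc j})) UNIV"
    by (rule indep_vars_compose2) measurable
  then show ?thesis by simp
qed

text \<open>Optional stopping for a product martingale at the bounded time
  \<open>min \<kappa> K\<close>. The event that \<kappa> exceeds \<open>k\<close> is determined by
  the factors with index below \<open>k\<close>, hence independent of the factor with index
  \<open>k\<close>, which has mean 1. Induction on the truncation level adds one factor at a time;
  with nonnegative integrals no integrability has to be tracked.\<close>

lemma (in prob_space) nn_integral_stopped_prod:
  fixes D :: "nat \<Rightarrow> 'a \<Rightarrow> real" and f :: "real \<Rightarrow> real"
  assumes ind: "indep_vars (\<lambda>_. borel) D {..<K}"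
    and f_nonneg: "\<And>y. 0 \<le> f y" and f_meas[measurable]: "f \<in> borel_measurable borel"
    and mean: "\<And>i. i < K \<Longrightarrow> (\<integral>\<^sup>+\<omega>. ennreal (f (D i \<omega>)) \<partial>M) = 1"
    and \<kappa>: "\<And>k. k < K \<Longrightarrow> {\<omega> \<in> space M. \<kappa> \<omega> \<le> k} \<in>
      sets (vimage_algebra (space M) (\<lambda>\<omega>. \<lambda>i\<in>{..<k}. D i \<omega>) (PiM {..<k} (\<lambda>_. borel)))"
  shows "(\<integral>\<^sup>+\<omega>. ennreal (\<Prod>i<min (\<kappa> \<omega>) K. f (D i \<omega>)) \<partial>M) = 1"
proof -
  have D_meas: "D i \<in> borel_measurable M" if "i < K" for i
    using ind that by (auto simp: indep_vars_def)
  have \<kappa>_meas: "{\<omega> \<in> space M. \<kappa> \<omega> \<le> k} \<in> sets M" if "k < K" for k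
  proof -
    have "(\<lambda>\<omega>. \<lambda>i\<in>{..<k}. D i \<omega>) \<in> measurable M (PiM {..<k} (\<lambda>_. borel))"
      using that by (intro measurable_restrict D_meas) auto
    then show ?thesis
      using \<kappa>[OF that] sets_vimage_algebra_cong
      by (meson in_mono sets_image_in_sets)
  qed
  have "k \<le> K \<Longrightarrow> (\<integral>\<^sup>+\<omega>. ennreal (\<Prod>i<min (\<kappa> \<omega>) k. f (D i \<omega>)) \<partial>M) = 1" for k
  proof (induction k)
    case 0
    then show ?case by (simp add: emeasure_space_1)
  next
    case (Suc k)
    then have k: "k < K" by simp
    note [measurable] = \<kappa>_meas[OF k]
    define A where "A = {\<omega> \<in> space M. \<kappa> \<omega> > k}"
    have A_eq: "A = space M - {\<omega> \<in> space M. \<kappa> \<omega> \<le> k}" by (auto simp: A_def)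
    have [measurable]: "A \<in> sets M" unfolding A_eq by measurable
    let ?R = "\<lambda>\<omega>. \<lambda>i\<in>{..<k}. D i \<omega>"
    \<comment> \<open>The event is a preimage under the vector of the first \<open>k\<close>
      increments, so its indicator becomes a function of that vector, the form required by
      \<open>indep_var_compose\<close>.\<close>
    have "{\<omega> \<in> space M. \<kappa> \<omega> \<le> k} \<in> {?R -` B \<inter> space M | B. B \<in> sets (PiM {..<k} (\<lambda>_. borel))}"
      using \<kappa>[OF k] by (subst (asm) sets_vimage_algebra2) (auto simp: space_PiM)
    then obtain B where B[measurable]: "B \<in> sets (PiM {..<k} (\<lambda>_. borel))"
      and B_eq: "{\<omega> \<in> space M. \<kappa> \<omega> \<le> k} = ?R -` B \<inter> space M" by blast
    have [measurable]: "D i \<in> borel_measurable M" if "i \<in> {..<Suc k}" for i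
      using that k by (intro D_meas) auto
    let ?Z = "\<lambda>k \<omega>. \<Prod>i<k. f (D i \<omega>)"
    have Zmin_meas: "(\<lambda>\<omega>. ?Z (min (\<kappa> \<omega>) j) \<omega>) \<in> borel_measurable M" if "j \<le> Suc k" for j
    proof -
      \<comment> \<open>Over a fixed range with factors switched to 1 from \<kappa> on,
        measurability can be checked factor by factor.\<close>
      have *: "?Z (min (\<kappa> \<omega>) j) \<omega> = (\<Prod>i<j. if \<kappa> \<omega> \<le> i then 1 else f (D i \<omega>))" for \<omega>
        by (rule prod.mono_neutral_cong_left) auto
      have [measurable]: "Measurable.pred M (\<lambda>\<omega>. \<kappa> \<omega> \<le> i)" if "i \<in> {..<j}" for i
        using \<kappa>_meas[of i] that \<open>j \<le> Suc k\<close> k by (simp add: pred_def)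
      have [measurable]: "D i \<in> borel_measurable M" if "i \<in> {..<j}" for i
        using that \<open>j \<le> Suc k\<close> k by (intro D_meas) auto
      show ?thesis unfolding * by measurable
    qed
    note [measurable] = Zmin_meas[of k, simplified] Zmin_meas[of "Suc k", simplified]
    have indep: "indep_var borel (\<lambda>\<omega>. ?Z k \<omega> * indicator A \<omega>) borel (\<lambda>\<omega>. f (D k \<omega>))"
    proof -
      have "indep_var (PiM {..<k} (\<lambda>_. borel)) ?R (PiM {k} (\<lambda>_. borel)) (\<lambda>\<omega>. \<lambda>i\<in>{k}. D i \<omega>)"
        using k by (intro indep_var_restrict[OF ind]) auto
      then have "indep_var borel ((\<lambda>d. (\<Prod>i<k. f (d i)) * indicator (space (PiM {..<k} (\<lambda>_. borel)) - B) d) \<circ> ?R)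
          borel ((\<lambda>d. f (d k)) \<circ> (\<lambda>\<omega>. \<lambda>i\<in>{k}. D i \<omega>))"
        by (rule indep_var_compose) measurable
      moreover have "((\<lambda>d. f (d k)) \<circ> (\<lambda>\<omega>. \<lambda>i\<in>{k}. D i \<omega>)) = (\<lambda>\<omega>. f (D k \<omega>))" by auto
      ultimately have *: "indep_var borel ((\<lambda>d. (\<Prod>i<k. f (d i)) * indicator (space (PiM {..<k} (\<lambda>_. borel)) - B) d) \<circ> ?R)
          borel (\<lambda>\<omega>. f (D k \<omega>))" by simp
      have eq: "indicat_real (space (PiM {..<k} (\<lambda>_. borel)) - B) (?R \<omega>) = indicat_real A \<omega>" if "\<omega> \<in> space M" for \<omega>
      proof -
        have "\<kappa> \<omega> \<le> k \<longleftrightarrow> ?R \<omega> \<in> B"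
          using set_eq_iff[THEN iffD1, OF B_eq, rule_format, of \<omega>] that by simp
        then show ?thesis
          using that unfolding A_def by (auto simp: space_PiM indicator_def)
      qed
      \<comment> \<open>The composed function and the one with \<open>indicator A\<close> agree only
        on \<open>space M\<close>; passing to distributions makes this sufficient.\<close>
      show ?thesis
        using * unfolding indep_var_distribution_eq
        by (simp add: eq cong: measurable_cong distr_cong)
    qed
    \<comment> \<open>Off \<open>A\<close> the product has already stopped and does not change; on
      \<open>A\<close> it gains exactly the factor \<open>f (D k \<omega>)\<close>.\<close>
    have "(\<integral>\<^sup>+\<omega>. ennreal (?Z (min (\<kappa> \<omega>) (Suc k)) \<omega>) \<partial>M)
        = (\<integral>\<^sup>+\<omega>. ennreal (?Z (min (\<kappa> \<omega>) k) \<omega>) * indicator (space M - A) \<omega>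
            + ennreal ((?Z k \<omega> * indicator A \<omega>) * f (D k \<omega>)) \<partial>M)"
      by (intro nn_integral_cong) (auto simp: A_def indicator_def min_def le_Suc_eq not_less)
    also have "\<dots> = (\<integral>\<^sup>+\<omega>. ennreal (?Z (min (\<kappa> \<omega>) k) \<omega>) * indicator (space M - A) \<omega> \<partial>M)
        + (\<integral>\<^sup>+\<omega>. ennreal ((?Z k \<omega> * indicator A \<omega>) * f (D k \<omega>)) \<partial>M)"
      by (intro nn_integral_add) measurable
    also have "(\<integral>\<^sup>+\<omega>. ennreal ((?Z k \<omega> * indicator A \<omega>) * f (D k \<omega>)) \<partial>M)
        = (\<integral>\<^sup>+\<omega>. ennreal (?Z k \<omega> * indicator A \<omega>) \<partial>M)"
      by (subst indep_var_nn_integral_mult[OF indep])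
         (auto simp: f_nonneg prod_nonneg mean[OF k])
    also have "(\<integral>\<^sup>+\<omega>. ennreal (?Z (min (\<kappa> \<omega>) k) \<omega>) * indicator (space M - A) \<omega> \<partial>M) + \<dots>
       = (\<integral>\<^sup>+\<omega>. ennreal (?Z (min (\<kappa> \<omega>) k) \<omega>) * indicator (space M - A) \<omega>
          + ennreal (?Z k \<omega> * indicator A \<omega>) \<partial>M)"
      by (intro nn_integral_add[symmetric]) measurable
    also have "\<dots> = (\<integral>\<^sup>+\<omega>. ennreal (?Z (min (\<kappa> \<omega>) k) \<omega>) \<partial>M)"
      by (intro nn_integral_cong) (auto simp: A_def indicator_def min_def not_less)
    finally show ?case using Suc by simp
  qed
  then show ?thesis by blast
qed

section \<open>The mixture of exponentials and the boundary constant\<close>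

text \<open>This is the standard normal distribution function at \<open>z\<close> divided by its
  density at \<open>z\<close>, that is, the Mills ratio at \<open>- z\<close>.\<close>

definition mills :: "real \<Rightarrow> real" where
  "mills z = (LBINT l:{0..}. exp (l * z - l\<^sup>2 / 2))"

lemma exp_eq_normal_density:
  fixes l z :: real
  shows "exp (l * z - l\<^sup>2 / 2) = exp (z\<^sup>2 / 2) * sqrt (2 * pi) * normal_density z 1 l"
  by (simp add: normal_density_def exp_add[symmetric] exp_diff[symmetric] power2_eq_square field_simps flip: exp_add)

lemma integrable_mills: "set_integrable lborel {0..} (\<lambda>l::real. exp (l * z - l\<^sup>2 / 2))"
proof -
  have "integrable lborel (\<lambda>l::real. exp (l * z - l\<^sup>2 / 2))"
    unfolding exp_eq_normal_density by simp
  then show ?thesis unfolding set_integrable_def by (rule integrable_mult_indicator[rotated]) simp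
qed

lemma integrable_mills_moment: "set_integrable lborel {0..} (\<lambda>l::real. (l - z) * exp (l * z - l\<^sup>2 / 2))"
proof -
  have "integrable lborel (\<lambda>l::real. (exp (z\<^sup>2 / 2) * sqrt (2 * pi)) * (normal_density z 1 l * (l - z) ^ 1))"
    by (intro integrable_mult_right integrable_normal_moment) auto
  then have "integrable lborel (\<lambda>l::real. (l - z) * exp (l * z - l\<^sup>2 / 2))"
    unfolding exp_eq_normal_density by (simp add: mult_ac)
  then show ?thesis unfolding set_integrable_def by (rule integrable_mult_indicator[rotated]) simp
qed

text \<open>The integrand is the derivative of \<open>- exp (l * z - l\<^sup>2 / 2)\<close>, which
  goes from -1 at 0 to 0 at infinity. The identity stands in for the formula
  \<open>1 + z * mills z\<close> for the derivative of \<open>mills\<close>, without differentiating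
  under the integral.\<close>

lemma mills_moment: "(LBINT l:{0..}. ((l::real) - z) * exp (l * z - l\<^sup>2 / 2)) = 1"
proof -
  have "(LBINT l=0..\<infinity>. ((l::real) - z) * exp (l * z - l\<^sup>2 / 2)) = 0 - (-1)"
  proof (rule interval_integral_FTC_integrable[where F="\<lambda>l. - exp (l * z - l\<^sup>2 / 2)"])
    show "((\<lambda>l::real. - exp (l * z - l\<^sup>2 / 2)) has_vector_derivative (l - z) * exp (l * z - l\<^sup>2 / 2)) (at l)" for l
      unfolding has_real_derivative_iff_has_vector_derivative[symmetric]
      by (auto intro!: derivative_eq_intros simp: algebra_simps)
    show "set_integrable lborel (einterval 0 \<infinity>) (\<lambda>l::real. (l - z) * exp (l * z - l\<^sup>2 / 2))"
      by (rule set_integrable_subset[OF integrable_mills_moment]) (auto simp: einterval_def)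
    have "((\<lambda>l::real. - exp (l * z - l\<^sup>2 / 2)) \<longlongrightarrow> - exp (0 * z - 0\<^sup>2 / 2)) (at_right 0)"
      by (intro tendsto_intros) auto
    then show "(((\<lambda>l::real. - exp (l * z - l\<^sup>2 / 2)) \<circ> real_of_ereal) \<longlongrightarrow> -1) (at_right 0)"
      unfolding zero_ereal_def ereal_tendsto_simps1 by simp
    have "((\<lambda>l::real. - exp (l * z - l\<^sup>2 / 2)) \<longlongrightarrow> 0) at_top"
      by real_asymp
    then show "(((\<lambda>l::real. - exp (l * z - l\<^sup>2 / 2)) \<circ> real_of_ereal) \<longlongrightarrow> 0) (at_left \<infinity>)"
      by (simp add: ereal_tendsto_simps1)
  qed auto
  then have "(LBINT l:{0<..}. (l - z) * exp (l * z - l\<^sup>2 / 2)) = 1"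
    by (simp add: interval_integral_to_infinity_eq[where a=0, unfolded zero_ereal_def[symmetric]])
  also have "(LBINT l:{0<..}. (l - z) * exp (l * z - l\<^sup>2 / 2)) = (LBINT l:{0..}. (l - z) * exp (l * z - l\<^sup>2 / 2))"
    using AE_lborel_singleton[of "0::real"]
    by (intro set_integral_cong_set) (auto simp: set_borel_measurable_def)
  finally show ?thesis .
qed

lemma mills_pos: "mills z > 0"
proof -
  have "mills z \<noteq> 0"
  proof
    assume "mills z = 0"
    then have "(\<integral>l. indicator {0..} l * exp (l * z - l\<^sup>2 / 2) \<partial>lborel) = 0"
      by (simp add: mills_def set_lebesgue_integral_def)
    then have "AE l::real in lborel. indicator {0..} l * exp (l * z - l\<^sup>2 / 2) = 0"
      using integrable_mills[of z]
      by (subst (asm) integral_nonneg_eq_0_iff_AE) (auto simp: set_integrable_def)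
    then have "AE l::real in lborel. l \<notin> {0..}"
      by (auto simp: indicator_def split: if_splits)
    then have "emeasure lborel {0::real..} = 0"
      by (subst (asm) AE_iff_measurable[of "{0..}"]) auto
    moreover have "emeasure lborel {0::real..1} \<le> emeasure lborel {0::real..}"
      by (intro emeasure_mono) auto
    ultimately show False by simp
  qed
  moreover have "mills z \<ge> 0"
    unfolding mills_def set_lebesgue_integral_def by (intro integral_nonneg_AE) auto
  ultimately show ?thesis by simp
qed

text \<open>A mixture of exponentials in \<open>z\<close>, each of them convex. Convexity is the
  source of the continuity in the intermediate value argument for \<alpha>.\<close>

lemma convex_on_mills: "convex_on UNIV mills"
proof (rule convex_onI)
  fix u x y :: real assume u: "0 < u" "u < 1"
  let ?e = "\<lambda>z l::real. exp (l * z - l\<^sup>2 / 2)"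
  have "mills ((1 - u) *\<^sub>R x + u *\<^sub>R y) \<le> (LBINT l:{0..}. (1 - u) * ?e x l + u * ?e y l)"
    unfolding mills_def
  proof (rule set_integral_mono)
    show "set_integrable lborel {0..} (\<lambda>l. (1 - u) * ?e x l + u * ?e y l)"
      using integrable_mills by (intro set_integral_add set_integrable_mult_right) auto
    show "?e ((1 - u) *\<^sub>R x + u *\<^sub>R y) l \<le> (1 - u) * ?e x l + u * ?e y l" for l
    proof -
      have eq: "l * ((1 - u) *\<^sub>R x + u *\<^sub>R y) - l\<^sup>2 / 2
          = (1 - u) *\<^sub>R (l * x - l\<^sup>2 / 2) + u *\<^sub>R (l * y - l\<^sup>2 / 2)"
        by (simp add: field_simps)
      show ?thesis
        unfolding eq using convex_onD[OF exp_convex, of u] u by auto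
    qed
  qed (rule integrable_mills)
  also have "\<dots> = (1 - u) * mills x + u * mills y"
    unfolding mills_def using integrable_mills
    by (subst set_integral_add) auto
  finally show "mills ((1 - u) *\<^sub>R x + u *\<^sub>R y) \<le> (1 - u) * mills x + u * mills y" .
qed simp

text \<open>Mixing over \<open>l \<ge> 0\<close> only makes every exponent nondecreasing in
  \<open>z\<close>.\<close>

lemma mills_mono: "y \<le> z \<Longrightarrow> mills y \<le> mills z"
  unfolding mills_def set_lebesgue_integral_def
  by (intro integral_mono integrable_mills[unfolded set_integrable_def])
     (auto simp: indicator_def mult_left_mono)

text \<open>The root is the constant of Shepp's optimal boundary \<open>\<alpha> * sqrt t\<close>.\<close>

lemma ex_shepp_constant:
  obtains \<alpha> where "0 < \<alpha>" "\<alpha> < 1" "(1 - \<alpha>\<^sup>2) * mills \<alpha> = \<alpha>"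
proof -
  have cont: "continuous_on {0..1} mills"
    using convex_on_continuous[OF open_UNIV convex_on_mills] continuous_on_subset by blast
  \<comment> \<open>The continuous function is \<open>- mills 0 < 0\<close> at 0 and 1 at 1, so it
    has a root, which is neither endpoint.\<close>
  have "\<exists>\<alpha>. 0 \<le> \<alpha> \<and> \<alpha> \<le> 1 \<and> \<alpha> - (1 - \<alpha>\<^sup>2) * mills \<alpha> = 0"
    using mills_pos[of 0] by (intro IVT' continuous_intros cont) auto
  then obtain \<alpha> where \<alpha>: "0 \<le> \<alpha>" "\<alpha> \<le> 1" "(1 - \<alpha>\<^sup>2) * mills \<alpha> = \<alpha>" by auto
  then have "\<alpha> \<noteq> 0" "\<alpha> \<noteq> 1" using mills_pos[of 0] by auto
  with \<alpha> show thesis by (intro that[of \<alpha>]) linarith+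
qed

text \<open>At a Shepp constant the line \<open>z\<close> is the tangent of the convex function
  \<open>(1 - \<alpha>\<^sup>2) * mills z\<close> at \<open>\<alpha>\<close> (smooth fit), hence lies below it.\<close>

lemma shepp_tangent:
  assumes \<alpha>: "0 < \<alpha>" "\<alpha> < 1" "(1 - \<alpha>\<^sup>2) * mills \<alpha> = \<alpha>"
  shows "z \<le> (1 - \<alpha>\<^sup>2) * mills z"
proof -
  let ?e = "\<lambda>z l::real. exp (l * z - l\<^sup>2 / 2)"
  have int: "set_integrable lborel {0..} (\<lambda>l. (1 + (z - \<alpha>) * \<alpha>) * ?e \<alpha> l + (z - \<alpha>) * ((l - \<alpha>) * ?e \<alpha> l))"
    using integrable_mills integrable_mills_moment by (intro set_integral_add set_integrable_mult_right) auto
  \<comment> \<open>This is the tangent of \<open>mills\<close> at \<alpha>, obtained under the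
    integral from \<open>1 + u \<le> exp u\<close> with \<open>u = l * (z - \<alpha>)\<close>.
    Writing \<open>l\<close> as \<open>\<alpha> + (l - \<alpha>)\<close> lets
    \<open>mills_moment\<close> evaluate the linear term.\<close>
  have "(1 + (z - \<alpha>) * \<alpha>) * mills \<alpha> + (z - \<alpha>)
      = (LBINT l:{0..}. (1 + (z - \<alpha>) * \<alpha>) * ?e \<alpha> l + (z - \<alpha>) * ((l - \<alpha>) * ?e \<alpha> l))"
    using integrable_mills integrable_mills_moment
    by (subst set_integral_add) (auto simp: mills_def mills_moment)
  also have "\<dots> \<le> mills z"
    unfolding mills_def
  proof (rule set_integral_mono[OF int integrable_mills])
    fix l :: real
    have "(1 + (z - \<alpha>) * \<alpha>) * ?e \<alpha> l + (z - \<alpha>) * ((l - \<alpha>) * ?e \<alpha> l) = (1 + l * (z - \<alpha>)) * ?e \<alpha> l"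
      by (simp add: algebra_simps)
    also have "\<dots> \<le> exp (l * (z - \<alpha>)) * ?e \<alpha> l"
      by (intro mult_right_mono) auto
    also have "\<dots> = ?e z l" by (simp add: exp_add[symmetric] algebra_simps)
    finally show "(1 + (z - \<alpha>) * \<alpha>) * ?e \<alpha> l + (z - \<alpha>) * ((l - \<alpha>) * ?e \<alpha> l) \<le> ?e z l" .
  qed
  finally have le: "(1 + (z - \<alpha>) * \<alpha>) * mills \<alpha> + (z - \<alpha>) \<le> mills z" .
  have pos: "1 - \<alpha>\<^sup>2 > 0" using \<alpha> by (simp add: power2_eq_square mult_less_cancel_left1 less_1_mult abs_square_less_1[unfolded power2_eq_square])
  \<comment> \<open>By the equation for \<alpha>, the scaled tangent has the value \<alpha> at
    \<alpha> and the slope \<open>\<alpha>\<^sup>2 + (1 - \<alpha>\<^sup>2) = 1\<close>.\<close>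
  have "(1 - \<alpha>\<^sup>2) * ((1 + (z - \<alpha>) * \<alpha>) * mills \<alpha> + (z - \<alpha>))
      = (1 + (z - \<alpha>) * \<alpha>) * ((1 - \<alpha>\<^sup>2) * mills \<alpha>) + (1 - \<alpha>\<^sup>2) * (z - \<alpha>)"
    by (simp add: algebra_simps)
  also have "\<dots> = z"
    unfolding \<alpha>(3) by (simp add: algebra_simps power2_eq_square)
  finally show ?thesis
    using mult_left_mono[OF le, of "1 - \<alpha>\<^sup>2"] pos by simp
qed

text \<open>The function \<phi> of the overview without its factor
  \<open>1 - \<alpha>\<^sup>2\<close>. Values in \<open>ennreal\<close> let Tonelli's theorem apply
  without integrability conditions.\<close>

definition expint :: "real \<Rightarrow> real \<Rightarrow> ennreal" where
  "expint t y = (\<integral>\<^sup>+l\<in>{0..}. ennreal (exp (l * y - l\<^sup>2 * t / 2)) \<partial>lborel)"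

text \<open>Brownian scaling: the substitution of \<open>l / sqrt t\<close> for \<open>l\<close>
  reduces two variables to the single ratio \<open>y / sqrt t\<close>.\<close>

lemma expint_eq_mills:
  assumes "t > 0"
  shows "expint t y = ennreal (mills (y / sqrt t) / sqrt t)"
proof -
  let ?f = "\<lambda>l. ennreal (indicator {0..} l * exp (l * y - l\<^sup>2 * t / 2))"
  have "expint t y = (\<integral>\<^sup>+l. ?f l \<partial>lborel)"
    unfolding expint_def by (intro nn_integral_cong) (auto simp: indicator_def)
  also have "\<dots> = ennreal \<bar>1 / sqrt t\<bar> * (\<integral>\<^sup>+l. ?f (0 + (1 / sqrt t) * l) \<partial>lborel)"
    using assms by (intro nn_integral_real_affine) auto
  also have "(\<integral>\<^sup>+l. ?f (0 + (1 / sqrt t) * l) \<partial>lborel)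
      = (\<integral>\<^sup>+l. ennreal (indicator {0..} l *\<^sub>R exp (l * (y / sqrt t) - l\<^sup>2 / 2)) \<partial>lborel)"
    using assms by (intro nn_integral_cong)
      (auto simp: indicator_def power_divide zero_le_divide_iff)
  also have "\<dots> = ennreal (mills (y / sqrt t))"
    unfolding mills_def set_lebesgue_integral_def
    using integrable_mills[of "y / sqrt t"]
    by (intro nn_integral_eq_integral) (auto simp: set_integrable_def)
  finally show ?thesis
    using assms mills_pos[of "y / sqrt t"] by (simp add: ennreal_mult[symmetric] less_imp_le)
qed

section \<open>The upper bound for the walk\<close>

text \<open>The tangent inequality at \<open>y / sqrt t\<close>, divided by \<open>sqrt t\<close>.
  On the left, \<open>ennreal\<close> replaces negative payoffs by 0.\<close>

lemma payoff_le_expint: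
  assumes \<alpha>: "0 < \<alpha>" "\<alpha> < 1" "(1 - \<alpha>\<^sup>2) * mills \<alpha> = \<alpha>" and t: "t > 0"
  shows "ennreal (y / t) \<le> ennreal (1 - \<alpha>\<^sup>2) * expint t y"
proof -
  have "y / t = (y / sqrt t) / sqrt t" using t by simp
  also have "\<dots> \<le> ((1 - \<alpha>\<^sup>2) * mills (y / sqrt t)) / sqrt t"
    using t by (intro divide_right_mono shepp_tangent[OF \<alpha>]) auto
  finally have "y / t \<le> (1 - \<alpha>\<^sup>2) * (mills (y / sqrt t) / sqrt t)" by simp
  moreover have "0 \<le> 1 - \<alpha>\<^sup>2" using \<alpha> by (simp add: power_le_one)
  ultimately show ?thesis
    using t mills_pos[of "y / sqrt t"]
    by (subst expint_eq_mills) (auto simp: ennreal_mult[symmetric] intro!: ennreal_leI)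
qed

text \<open>Tonelli's theorem; the starting point \<open>(t, x)\<close> splits off because it enters
  the exponent additively. A bound by 1 on the stopped exponential for each single \<open>l\<close>
  thereby becomes a comparison with \<open>expint t x\<close>, from above for the walk and from
  below for Brownian motion.\<close>

lemma (in sigma_finite_measure) nn_integral_expint:
  assumes [measurable]: "\<sigma> \<in> borel_measurable M" "Y \<in> borel_measurable M"
  shows "(\<integral>\<^sup>+\<omega>. expint (t + \<sigma> \<omega>) (x + Y \<omega>) \<partial>M)
    = (\<integral>\<^sup>+l\<in>{0..}. ennreal (exp (l * x - l\<^sup>2 * t / 2)) *
        (\<integral>\<^sup>+\<omega>. ennreal (exp (l * Y \<omega> - l\<^sup>2 * \<sigma> \<omega> / 2)) \<partial>M) \<partial>lborel)"
proof -
  interpret pair_sigma_finite M lborel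
    by (intro pair_sigma_finite.intro sigma_finite_measure_axioms sigma_finite_lborel)
  have split: "exp (l * (x + Y \<omega>) - l\<^sup>2 * (t + \<sigma> \<omega>) / 2)
      = exp (l * x - l\<^sup>2 * t / 2) * exp (l * Y \<omega> - l\<^sup>2 * \<sigma> \<omega> / 2)" for l \<omega>
    by (simp add: exp_add[symmetric] algebra_simps add_divide_distrib)
  have "(\<integral>\<^sup>+\<omega>. expint (t + \<sigma> \<omega>) (x + Y \<omega>) \<partial>M)
      = (\<integral>\<^sup>+l. (\<integral>\<^sup>+\<omega>. ennreal (exp (l * (x + Y \<omega>) - l\<^sup>2 * (t + \<sigma> \<omega>) / 2)) * indicator {0..} l \<partial>M) \<partial>lborel)"
    unfolding expint_def by (intro Fubini'[symmetric]) measurable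
  also have "\<dots> = (\<integral>\<^sup>+l\<in>{0..}. ennreal (exp (l * x - l\<^sup>2 * t / 2)) *
        (\<integral>\<^sup>+\<omega>. ennreal (exp (l * Y \<omega> - l\<^sup>2 * \<sigma> \<omega> / 2)) \<partial>M) \<partial>lborel)"
    unfolding split
    by (intro nn_integral_cong) (simp add: ennreal_mult nn_integral_cmult nn_integral_multc)
  finally show ?thesis .
qed

text \<open>For integrable \<open>f\<close> the negative part is dropped. Otherwise the Bochner
  integral has the default value 0, which is covered by \<open>0 \<le> C\<close>.\<close>

lemma integral_le_enn2real_nn_integral:
  fixes f :: "'a \<Rightarrow> real"
  assumes "(\<integral>\<^sup>+\<omega>. ennreal (f \<omega>) \<partial>M) \<le> ennreal C" "0 \<le> C"
  shows "(\<integral>\<omega>. f \<omega> \<partial>M) \<le> C"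
proof (cases "integrable M f")
  case True
  then have "(\<integral>\<omega>. f \<omega> \<partial>M) \<le> enn2real (\<integral>\<^sup>+\<omega>. ennreal (f \<omega>) \<partial>M)"
    by (simp add: real_lebesgue_integral_def)
  also have "\<dots> \<le> C" using assms by (simp add: enn2real_leI)
  finally show ?thesis .
qed (simp add: not_integrable_integral_eq assms)

text \<open>Dividing each factor by its exact exponential moment \<open>r\<close> gives mean 1, so
  the stopped product has mean 1. Putting the larger number \<open>exp (l\<^sup>2 / 2)\<close> in
  place of \<open>r\<close> can only make the product smaller.\<close>

lemma (in prob_space) stopped_exponential_le_1:
  fixes X :: "nat \<Rightarrow> 'a \<Rightarrow> real" and \<tau> :: "'a \<Rightarrow> enat"
  assumes ind: "indep_vars (\<lambda>_. borel) X {1..}"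
    and iid: "\<And>i. i \<ge> 1 \<Longrightarrow> distr M borel (X i) = distr M borel (X 1)"
    and sub: "\<And>i. i \<ge> 1 \<Longrightarrow> subgaussian1 M (X i)"
    and \<tau>: "stopping_time (natural_filtration M UNIV enat (partial_sum X)) \<tau>"
  shows "(\<integral>\<^sup>+\<omega>. ennreal (exp (l * partial_sum X (the_enat (min (\<tau> \<omega>) (enat n))) \<omega>
      - l\<^sup>2 * real (the_enat (min (\<tau> \<omega>) (enat n))) / 2)) \<partial>M) \<le> 1"
proof -
  define D where "D i = X (Suc i)" for i
  have ps: "partial_sum X k \<omega> = (\<Sum>i<k. D i \<omega>)" for k \<omega>
    unfolding partial_sum_def D_def using sum.atLeast1_atMost_eq by simp
  have indD: "indep_vars (\<lambda>_. borel) D UNIV"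
    unfolding D_def by (rule indep_vars_nat_shift[OF ind])
  have D_meas[measurable]: "D i \<in> borel_measurable M" for i
    using indD by (auto simp: indep_vars_def)
  define m where "m = (\<integral>\<^sup>+\<omega>. ennreal (exp (l * D 0 \<omega>)) \<partial>M)"
  have mean: "(\<integral>\<^sup>+\<omega>. ennreal (exp (l * D i \<omega>)) \<partial>M) = m" for i
  proof -
    have d: "distr M borel (D i) = distr M borel (D 0)"
      unfolding D_def using iid[of "Suc i"] by simp
    have "(\<integral>\<^sup>+\<omega>. ennreal (exp (l * D i \<omega>)) \<partial>M) = (\<integral>\<^sup>+y. ennreal (exp (l * y)) \<partial>distr M borel (D i))" for i
      by (subst nn_integral_distr) auto
    then show ?thesis using d by (simp add: m_def)
  qed
  have m_le: "m \<le> ennreal (exp (l\<^sup>2 / 2))"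
    using sub[of 1] by (simp add: m_def D_def subgaussian1_def)
  have "m \<noteq> 0"
  proof
    assume "m = 0"
    then have "AE \<omega> in M. False"
      unfolding m_def by (subst (asm) nn_integral_0_iff_AE) auto
    then show False by simp
  qed
  \<comment> \<open>The subgaussian bound makes the moment finite and the positivity of
    \<open>exp\<close> makes it nonzero, so dividing by it is legitimate.\<close>
  with m_le obtain r where r: "m = ennreal r" "0 < r" "r \<le> exp (l\<^sup>2 / 2)"
    by (cases m) (auto simp: top_unique)
  define f where "f y = exp (l * y) / r" for y
  define \<kappa> where "\<kappa> \<omega> = the_enat (min (\<tau> \<omega>) (enat n))" for \<omega>
  have \<kappa>_le: "\<kappa> \<omega> \<le> n" for \<omega>
    unfolding \<kappa>_def by (cases "\<tau> \<omega>") auto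
  have \<kappa>_iff: "\<kappa> \<omega> \<le> k \<longleftrightarrow> \<tau> \<omega> \<le> enat k" if "k < n" for k \<omega>
    unfolding \<kappa>_def using that by (cases "\<tau> \<omega>") (auto simp: min_def)
  have "(\<integral>\<^sup>+\<omega>. ennreal (\<Prod>i<min (\<kappa> \<omega>) n. f (D i \<omega>)) \<partial>M) = 1"
  proof (rule nn_integral_stopped_prod[where D=D and f=f and K=n and \<kappa>=\<kappa>])
    show "indep_vars (\<lambda>_. borel) D {..<n}" using indD by (rule indep_vars_subset) simp
    show "f \<in> borel_measurable borel" unfolding f_def by measurable
    show "(\<integral>\<^sup>+\<omega>. ennreal (f (D i \<omega>)) \<partial>M) = 1" for i
    proof -
      have "(\<integral>\<^sup>+\<omega>. ennreal (f (D i \<omega>)) \<partial>M) = (\<integral>\<^sup>+\<omega>. ennreal (exp (l * D i \<omega>)) / ennreal r \<partial>M)"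
        using r by (simp add: f_def divide_ennreal)
      also have "\<dots> = 1"
        using r(2) by (subst nn_integral_divide) (auto simp: mean r(1) divide_ennreal)
      finally show ?thesis .
    qed
    fix k assume k: "k < n"
    let ?R = "\<lambda>\<omega>. \<lambda>i\<in>{..<k}. D i \<omega>"
    let ?V = "vimage_algebra (space M) ?R (PiM {..<k} (\<lambda>_. borel))"
    have R: "?R \<in> measurable ?V (PiM {..<k} (\<lambda>_. borel))"
      by (rule measurable_vimage_algebra1) (auto simp: space_PiM)
    \<comment> \<open>Partial sums up to \<open>k\<close> are functions of the first
      \<open>k\<close> increments, so the natural filtration at \<open>k\<close> lies in the algebra
      \<open>?V\<close> demanded by \<open>nn_integral_stopped_prod\<close>.\<close>
    have S: "partial_sum X i \<in> borel_measurable ?V" if "i \<le> k" for i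
    proof -
      have "(\<lambda>d. \<Sum>j<i. d j) \<in> borel_measurable (PiM {..<k} (\<lambda>_. borel :: real measure))"
        using that by (intro borel_measurable_sum measurable_component_singleton) auto
      from measurable_compose[OF R this] show ?thesis
        using that by (simp add: ps[abs_def])
    qed
    have "sets (natural_filtration M UNIV enat (partial_sum X) (enat k)) \<subseteq> sets ?V"
      unfolding natural_filtration_def
      by (subst sets_measure_of)
        (use measurable_sets[OF S] in \<open>auto intro!: sets.sigma_sets_subset[of _ ?V, simplified]\<close>)
    moreover have "{\<omega> \<in> space M. \<tau> \<omega> \<le> enat k} \<in> sets (natural_filtration M UNIV enat (partial_sum X) (enat k))"
      using stopping_timeD[OF \<tau>, of "enat k"] filtration.space_F[OF filtration_natural_filtration, of M UNIV enat "partial_sum X"]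
      by (simp add: pred_def)
    ultimately show "{\<omega> \<in> space M. \<kappa> \<omega> \<le> k} \<in> sets ?V"
      using \<kappa>_iff[OF k] by auto
  qed (use r in \<open>auto simp: f_def\<close>)
  moreover have "exp (l * partial_sum X (\<kappa> \<omega>) \<omega> - l\<^sup>2 * real (\<kappa> \<omega>) / 2)
      \<le> (\<Prod>i<min (\<kappa> \<omega>) n. f (D i \<omega>))" for \<omega>
  proof -
    have "exp (l * partial_sum X (\<kappa> \<omega>) \<omega> - l\<^sup>2 * real (\<kappa> \<omega>) / 2)
        = exp (l * partial_sum X (\<kappa> \<omega>) \<omega>) / exp (l\<^sup>2 / 2) ^ \<kappa> \<omega>"
      by (simp add: exp_diff exp_of_nat_mult[symmetric] mult.commute)
    also have "\<dots> \<le> exp (l * partial_sum X (\<kappa> \<omega>) \<omega>) / r ^ \<kappa> \<omega>"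
      using r by (intro divide_left_mono power_mono) auto
    also have "\<dots> = (\<Prod>i<min (\<kappa> \<omega>) n. f (D i \<omega>))"
      using \<kappa>_le[of \<omega>] by (simp add: ps f_def prod_dividef exp_sum sum_distrib_left)
    finally show ?thesis .
  qed
  ultimately show ?thesis
    unfolding \<kappa>_def[symmetric] by (metis (no_types, lifting) ennreal_leI nn_integral_mono)
qed

section \<open>Unbounded stopping times of the walk\<close>

lemma (in prob_space) measurable_the_enat_stopping_time:
  assumes S[measurable]: "\<And>i. S i \<in> borel_measurable M"
    and \<tau>: "stopping_time (natural_filtration M UNIV enat S) \<tau>"
  shows "(\<lambda>\<omega>. the_enat (\<tau> \<omega>)) \<in> measurable M (count_space UNIV)"
proof -
  have "\<tau> \<in> borel_measurable M"
  proof (rule measurable_stopping_time[OF \<tau>])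
    show "sets (natural_filtration M UNIV enat S k) \<subseteq> sets M" for k
      unfolding natural_filtration_def
      by (subst sets_measure_of)
        (use S in \<open>auto intro!: sets.sigma_sets_subset dest: measurable_sets\<close>)
    show "space (natural_filtration M UNIV enat S k) = space M" for k
      by (rule filtration.space_F[OF filtration_natural_filtration])
  qed
  then have [measurable]: "\<tau> -` {e} \<inter> space M \<in> sets M" for e
    by (intro measurable_sets[of _ _ borel]) auto
  have "\<tau> \<in> measurable M (count_space UNIV)"
    by (subst measurable_count_space_eq2_countable) auto
  then show ?thesis by measurable
qed

lemma (in prob_space) borel_measurable_partial_sum:
  assumes "indep_vars (\<lambda>_. borel) X {1..}"
  shows "partial_sum X k \<in> borel_measurable M"
  using assms unfolding partial_sum_def[abs_def] indep_vars_def
  by (intro borel_measurable_sum) auto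

text \<open>The supermartingale bound. Where \<tau> is finite, its truncations at \<open>n\<close>
  eventually equal \<tau>, so Fatou's lemma carries the bound 1 from the truncated times to \<tau>
  itself; this is done for each \<open>l\<close> before mixing.\<close>

lemma (in prob_space) nn_integral_expint_walk_le:
  fixes X :: "nat \<Rightarrow> 'a \<Rightarrow> real" and \<tau> :: "'a \<Rightarrow> enat"
  assumes ind: "indep_vars (\<lambda>_. borel) X {1..}"
    and iid: "\<And>i. i \<ge> 1 \<Longrightarrow> distr M borel (X i) = distr M borel (X 1)"
    and sub: "\<And>i. i \<ge> 1 \<Longrightarrow> subgaussian1 M (X i)"
    and \<tau>: "stopping_time (natural_filtration M UNIV enat (partial_sum X)) \<tau>"
    and fin: "AE \<omega> in M. \<tau> \<omega> < \<infinity>"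
  shows "(\<integral>\<^sup>+\<omega>. expint (t + real (the_enat (\<tau> \<omega>))) (x + partial_sum X (the_enat (\<tau> \<omega>)) \<omega>) \<partial>M) \<le> expint t x"
proof -
  note [measurable] = borel_measurable_partial_sum[OF ind]
  have [measurable]: "(\<lambda>\<omega>. the_enat (\<tau> \<omega>)) \<in> measurable M (count_space UNIV)"
    by (rule measurable_the_enat_stopping_time[OF _ \<tau>]) measurable
  have [measurable]: "(\<lambda>\<omega>. the_enat (min (\<tau> \<omega>) (enat n))) \<in> measurable M (count_space UNIV)" for n
    by (intro measurable_the_enat_stopping_time[where S="partial_sum X"]
        stopping_time_min \<tau> stopping_time_const) measurable
  let ?g = "\<lambda>l k \<omega>. ennreal (exp (l * partial_sum X k \<omega> - l\<^sup>2 * real k / 2))"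
  have le1: "(\<integral>\<^sup>+\<omega>. ?g l (the_enat (\<tau> \<omega>)) \<omega> \<partial>M) \<le> 1" for l
  proof -
    let ?h = "\<lambda>n \<omega>. ?g l (the_enat (min (\<tau> \<omega>) (enat n))) \<omega>"
    have "(\<integral>\<^sup>+\<omega>. ?g l (the_enat (\<tau> \<omega>)) \<omega> \<partial>M) = (\<integral>\<^sup>+\<omega>. liminf (\<lambda>n. ?h n \<omega>) \<partial>M)"
    proof (rule nn_integral_cong_AE, use fin in eventually_elim)
      fix \<omega> assume "\<tau> \<omega> < \<infinity>"
      then obtain k where k: "\<tau> \<omega> = enat k" by (cases "\<tau> \<omega>") auto
      have "(\<lambda>n. ?h n \<omega>) \<longlonglongrightarrow> ?g l k \<omega>"
        by (rule tendsto_eventually, rule eventually_sequentiallyI[of k]) (simp add: k min_def)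
      then show "?g l (the_enat (\<tau> \<omega>)) \<omega> = liminf (\<lambda>n. ?h n \<omega>)"
        unfolding k the_enat.simps by (rule lim_imp_Liminf[OF sequentially_bot, symmetric])
    qed
    also have "\<dots> \<le> liminf (\<lambda>n. \<integral>\<^sup>+\<omega>. ?h n \<omega> \<partial>M)"
      by (rule nn_integral_liminf) measurable
    also have "\<dots> \<le> liminf (\<lambda>n. 1)"
      by (intro Liminf_mono always_eventually allI stopped_exponential_le_1[OF ind iid sub \<tau>])
    finally show ?thesis by (simp add: Liminf_const)
  qed
  have "(\<integral>\<^sup>+\<omega>. expint (t + real (the_enat (\<tau> \<omega>))) (x + partial_sum X (the_enat (\<tau> \<omega>)) \<omega>) \<partial>M)
    = (\<integral>\<^sup>+l\<in>{0..}. ennreal (exp (l * x - l\<^sup>2 * t / 2)) * (\<integral>\<^sup>+\<omega>. ?g l (the_enat (\<tau> \<omega>)) \<omega> \<partial>M) \<partial>lborel)"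
    by (rule nn_integral_expint) measurable
  also have "\<dots> \<le> (\<integral>\<^sup>+l\<in>{0..}. ennreal (exp (l * x - l\<^sup>2 * t / 2)) * 1 \<partial>lborel)"
    by (intro nn_integral_mono mult_right_mono mult_left_mono le1) auto
  finally show ?thesis by (simp add: expint_def)
qed

lemma (in prob_space) V_walk_le_mills:
  fixes X :: "nat \<Rightarrow> 'a \<Rightarrow> real"
  assumes ind: "indep_vars (\<lambda>_. borel) X {1..}"
    and iid: "\<And>i. i \<ge> 1 \<Longrightarrow> distr M borel (X i) = distr M borel (X 1)"
    and sub: "\<And>i. i \<ge> 1 \<Longrightarrow> subgaussian1 M (X i)"
    and t: "t > 0" and \<alpha>: "0 < \<alpha>" "\<alpha> < 1" "(1 - \<alpha>\<^sup>2) * mills \<alpha> = \<alpha>"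
  shows "V_walk M (partial_sum X) t x \<le> ereal ((1 - \<alpha>\<^sup>2) * (mills (x / sqrt t) / sqrt t))"
  unfolding V_walk_def
proof (safe intro!: SUP_least)
  fix \<tau> :: "'a \<Rightarrow> enat"
  assume \<tau>: "stopping_time (natural_filtration M UNIV enat (partial_sum X)) \<tau>"
    and fin: "AE \<omega> in M. \<tau> \<omega> < \<infinity>"
  have c: "0 \<le> 1 - \<alpha>\<^sup>2" using \<alpha> by (simp add: power_le_one)
  note [measurable] = borel_measurable_partial_sum[OF ind]
  have [measurable]: "(\<lambda>\<omega>. the_enat (\<tau> \<omega>)) \<in> measurable M (count_space UNIV)"
    by (rule measurable_the_enat_stopping_time[OF _ \<tau>]) measurable
  have [measurable]: "(\<lambda>\<omega>. expint (t + real (the_enat (\<tau> \<omega>))) (x + partial_sum X (the_enat (\<tau> \<omega>)) \<omega>))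
      \<in> borel_measurable M"
    unfolding expint_def by measurable
  have "(\<integral>\<^sup>+\<omega>. ennreal ((x + partial_sum X (the_enat (\<tau> \<omega>)) \<omega>) / (t + real (the_enat (\<tau> \<omega>)))) \<partial>M)
     \<le> (\<integral>\<^sup>+\<omega>. ennreal (1 - \<alpha>\<^sup>2) * expint (t + real (the_enat (\<tau> \<omega>))) (x + partial_sum X (the_enat (\<tau> \<omega>)) \<omega>) \<partial>M)"
    using t by (intro nn_integral_mono payoff_le_expint[OF \<alpha>]) (simp add: add_pos_nonneg)
  also have "\<dots> = ennreal (1 - \<alpha>\<^sup>2) * (\<integral>\<^sup>+\<omega>. expint (t + real (the_enat (\<tau> \<omega>))) (x + partial_sum X (the_enat (\<tau> \<omega>)) \<omega>) \<partial>M)"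
    by (rule nn_integral_cmult) measurable
  also have "\<dots> \<le> ennreal (1 - \<alpha>\<^sup>2) * expint t x"
    by (intro mult_left_mono nn_integral_expint_walk_le[OF ind iid sub \<tau> fin]) auto
  also have "\<dots> = ennreal ((1 - \<alpha>\<^sup>2) * (mills (x / sqrt t) / sqrt t))"
    using t c mills_pos[of "x / sqrt t"] by (simp add: expint_eq_mills ennreal_mult[symmetric])
  finally show "ereal (\<integral>\<omega>. (x + partial_sum X (the_enat (\<tau> \<omega>)) \<omega>) / (t + real (the_enat (\<tau> \<omega>))) \<partial>M)
     \<le> ereal ((1 - \<alpha>\<^sup>2) * (mills (x / sqrt t) / sqrt t))"
    using t c mills_pos[of "x / sqrt t"]
    unfolding ereal_less_eq by (intro integral_le_enn2real_nn_integral) auto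
qed

text \<open>Raising the starting point from the boundary value \<open>x0\<close> to \<open>x\<close> raises the payoff of every
  strategy by at most \<open>(x - x0) / t\<close>, with equality for immediate stopping.\<close>

lemma (in prob_space) V_walk_le_above_boundary:
  fixes X :: "nat \<Rightarrow> 'a \<Rightarrow> real"
  assumes ind: "indep_vars (\<lambda>_. borel) X {1..}"
    and iid: "\<And>i. i \<ge> 1 \<Longrightarrow> distr M borel (X i) = distr M borel (X 1)"
    and sub: "\<And>i. i \<ge> 1 \<Longrightarrow> subgaussian1 M (X i)"
    and t: "t > 0" and \<alpha>: "0 < \<alpha>" "\<alpha> < 1" "(1 - \<alpha>\<^sup>2) * mills \<alpha> = \<alpha>"
    and x: "\<alpha> * sqrt t \<le> x"
  shows "V_walk M (partial_sum X) t x \<le> ereal (x / t)"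
  unfolding V_walk_def
proof (safe intro!: SUP_least)
  fix \<tau> :: "'a \<Rightarrow> enat"
  assume \<tau>: "stopping_time (natural_filtration M UNIV enat (partial_sum X)) \<tau>"
    and fin: "AE \<omega> in M. \<tau> \<omega> < \<infinity>"
  let ?k = "\<lambda>\<omega>. the_enat (\<tau> \<omega>)"
  let ?p = "\<lambda>x \<omega>. (x + partial_sum X (?k \<omega>) \<omega>) / (t + real (?k \<omega>))"
  let ?x0 = "\<alpha> * sqrt t"
  note [measurable] = borel_measurable_partial_sum[OF ind]
  have [measurable]: "?k \<in> measurable M (count_space UNIV)"
    by (rule measurable_the_enat_stopping_time[OF _ \<tau>]) measurable
  have "V_walk M (partial_sum X) t ?x0 \<le> ereal ((1 - \<alpha>\<^sup>2) * (mills (?x0 / sqrt t) / sqrt t))"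
    by (rule V_walk_le_mills[OF ind iid sub t \<alpha>])
  \<comment> \<open>On the boundary the ratio \<open>?x0 / sqrt t\<close> is \<alpha>, so the
    equation for \<alpha> identifies the upper bound with the payoff of immediate stopping.\<close>
  also have "(1 - \<alpha>\<^sup>2) * (mills (?x0 / sqrt t) / sqrt t) = ?x0 / t"
  proof -
    have "(1 - \<alpha>\<^sup>2) * (mills (?x0 / sqrt t) / sqrt t) = \<alpha> / sqrt t"
      using t \<alpha>(3) by simp
    also have "\<dots> = ?x0 / t" using t by (simp add: field_simps)
    finally show ?thesis .
  qed
  finally have le0: "(\<integral>\<omega>. ?p ?x0 \<omega> \<partial>M) \<le> ?x0 / t"
    using \<tau> fin unfolding V_walk_def by (auto simp: SUP_le_iff)
  show "ereal (\<integral>\<omega>. ?p x \<omega> \<partial>M) \<le> ereal (x / t)"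
  proof (cases "integrable M (?p x)")
    case True
    have bd: "(x - ?x0) / (t + real (?k \<omega>)) \<le> (x - ?x0) / t" for \<omega>
      using x t by (intro divide_left_mono) (auto simp: add_pos_nonneg)
    have int: "integrable M (\<lambda>\<omega>. (x - ?x0) / (t + real (?k \<omega>)))"
    proof (rule integrable_const_bound[of _ "(x - ?x0) / t"])
      show "AE \<omega> in M. norm ((x - ?x0) / (t + real (?k \<omega>))) \<le> (x - ?x0) / t"
        using bd x t by (auto simp: abs_of_nonneg)
    qed measurable
    have eq: "?p ?x0 \<omega> = ?p x \<omega> - (x - ?x0) / (t + real (?k \<omega>))" for \<omega>
      by (simp add: diff_divide_distrib[symmetric])
    have int0: "integrable M (?p ?x0)"
      unfolding eq using True int by (rule Bochner_Integration.integrable_diff)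
    have "(\<integral>\<omega>. ?p x \<omega> \<partial>M) \<le> (\<integral>\<omega>. ?p ?x0 \<omega> + (x - ?x0) / t \<partial>M)"
    proof (rule integral_mono[OF True])
      show "?p x \<omega> \<le> ?p ?x0 \<omega> + (x - ?x0) / t" for \<omega>
        using bd[of \<omega>] unfolding eq by simp
    qed (use int0 in auto)
    also have "\<dots> = (\<integral>\<omega>. ?p ?x0 \<omega> \<partial>M) + (x - ?x0) / t"
      using int0 by (simp add: prob_space)
    also have "\<dots> \<le> ?x0 / t + (x - ?x0) / t" using le0 by simp
    also have "\<dots> = x / t" by (simp add: diff_divide_distrib)
    finally show ?thesis by simp
  next
    \<comment> \<open>The integral then has the default value 0, and \<open>x / t\<close> is
      nonnegative above the boundary.\<close>
    case False
    moreover have "0 \<le> x"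
      using x \<alpha>(1) t by (meson mult_nonneg_nonneg less_imp_le order_trans real_sqrt_ge_zero)
    ultimately show ?thesis using t by (simp add: not_integrable_integral_eq)
  qed
qed

section \<open>The lower bound for Brownian motion\<close>

text \<open>Completing the square: the exponential weight shifts the mean of the normal density from
  0 to \<open>l * s\<^sup>2\<close>.\<close>

lemma (in prob_space) nn_integral_exp_normal:
  assumes s: "0 < s" and D: "distributed M lborel Z (\<lambda>y. ennreal (normal_density 0 s y))"
  shows "(\<integral>\<^sup>+\<omega>. ennreal (exp (l * Z \<omega> - l\<^sup>2 * s\<^sup>2 / 2)) \<partial>M) = 1"
proof -
  interpret G: prob_space "density lborel (\<lambda>y. ennreal (normal_density (l * s\<^sup>2) s y))"
    using prob_space_normal_density[OF s] .
  have "(\<integral>\<^sup>+\<omega>. ennreal (exp (l * Z \<omega> - l\<^sup>2 * s\<^sup>2 / 2)) \<partial>M)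
      = (\<integral>\<^sup>+y. ennreal (normal_density 0 s y) * ennreal (exp (l * y - l\<^sup>2 * s\<^sup>2 / 2)) \<partial>lborel)"
    by (rule distributed_nn_integral[OF D, symmetric]) measurable
  also have "\<dots> = (\<integral>\<^sup>+y. ennreal (normal_density (l * s\<^sup>2) s y) \<partial>lborel)"
  proof (intro nn_integral_cong)
    fix y
    have "- (y - 0)\<^sup>2 / (2 * s\<^sup>2) + (l * y - l\<^sup>2 * s\<^sup>2 / 2) = - (y - l * s\<^sup>2)\<^sup>2 / (2 * s\<^sup>2)"
      using s by (simp add: field_simps power2_eq_square)
    then have "normal_density 0 s y * exp (l * y - l\<^sup>2 * s\<^sup>2 / 2) = normal_density (l * s\<^sup>2) s y"
      by (simp add: normal_density_def exp_add[symmetric] del: diff_0_right)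
    then show "ennreal (normal_density 0 s y) * ennreal (exp (l * y - l\<^sup>2 * s\<^sup>2 / 2)) = ennreal (normal_density (l * s\<^sup>2) s y)"
      by (simp add: ennreal_mult[symmetric])
  qed
  also have "\<dots> = 1"
    using G.emeasure_space_1 by (simp add: emeasure_density)
  finally show ?thesis .
qed

text \<open>The second moments make the sequence uniformly integrable, so no mass is lost in the limit.\<close>

lemma (in prob_space) nn_integral_limit_ge_1:
  fixes Y :: "nat \<Rightarrow> 'a \<Rightarrow> real"
  assumes meas[measurable]: "\<And>n. Y n \<in> borel_measurable M" and nonneg: "\<And>n \<omega>. 0 \<le> Y n \<omega>"
    and mean: "\<And>n. (\<integral>\<^sup>+\<omega>. ennreal (Y n \<omega>) \<partial>M) = 1"
    and second: "\<And>n. (\<integral>\<^sup>+\<omega>. ennreal ((Y n \<omega>)\<^sup>2) \<partial>M) \<le> ennreal C" and C: "0 \<le> C"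
    and lim: "\<And>\<omega>. \<omega> \<in> space M \<Longrightarrow> (\<lambda>n. Y n \<omega>) \<longlonglongrightarrow> Z \<omega>"
  shows "1 \<le> (\<integral>\<^sup>+\<omega>. ennreal (Z \<omega>) \<partial>M)"
proof (cases "\<integral>\<^sup>+\<omega>. ennreal (Z \<omega>) \<partial>M")
  case (real r)
  have [measurable]: "Z \<in> borel_measurable M"
    using lim meas by (rule borel_measurable_LIMSEQ_real)
  have Z_nonneg: "0 \<le> Z \<omega>" if "\<omega> \<in> space M" for \<omega>
    using LIMSEQ_le_const[OF lim[OF that]] nonneg by auto
  \<comment> \<open>Truncation at \<open>c\<close> makes dominated convergence available and costs
    at most \<open>C / c\<close>, because \<open>Y \<le> Y\<^sup>2 / c\<close> wherever
    \<open>Y\<close> exceeds \<open>c\<close>.\<close>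
  have key: "1 \<le> r + C / real (Suc k)" for k
  proof -
    define c where "c = real (Suc k)"
    have c: "c > 0" by (simp add: c_def)
    have int: "integrable M (\<lambda>\<omega>. min (Y n \<omega>) c)" for n
      using nonneg c by (intro integrable_const_bound[of _ c]) (auto simp: abs_of_nonneg min_def)
    have lim_min: "(\<lambda>n. \<integral>\<omega>. min (Y n \<omega>) c \<partial>M) \<longlonglongrightarrow> (\<integral>\<omega>. min (Z \<omega>) c \<partial>M)"
    proof (rule integral_dominated_convergence[where w="\<lambda>_. c"])
      show "AE \<omega> in M. (\<lambda>n. min (Y n \<omega>) c) \<longlonglongrightarrow> min (Z \<omega>) c"
        using lim by (intro AE_I2 tendsto_min) auto
      show "AE \<omega> in M. norm (min (Y n \<omega>) c) \<le> c" for n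
        using nonneg c by (intro AE_I2) (auto simp: abs_of_nonneg min_def)
    qed auto
    have "1 \<le> (\<integral>\<omega>. min (Y n \<omega>) c \<partial>M) + C / c" for n
    proof -
      have "1 = (\<integral>\<^sup>+\<omega>. ennreal (Y n \<omega>) \<partial>M)" by (simp add: mean)
      also have "\<dots> \<le> (\<integral>\<^sup>+\<omega>. ennreal (min (Y n \<omega>) c) + ennreal ((Y n \<omega>)\<^sup>2) / ennreal c \<partial>M)"
      proof (intro nn_integral_mono)
        fix \<omega>
        have "Y n \<omega> \<le> min (Y n \<omega>) c + (Y n \<omega>)\<^sup>2 / c"
          using nonneg[of n \<omega>] c by (auto simp: min_def field_simps power2_eq_square mult_right_mono intro: mult_mono add_increasing)
        then show "ennreal (Y n \<omega>) \<le> ennreal (min (Y n \<omega>) c) + ennreal ((Y n \<omega>)\<^sup>2) / ennreal c"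
          using nonneg[of n \<omega>] c
          by (simp add: divide_ennreal ennreal_plus[symmetric] ennreal_leI del: ennreal_plus)
      qed
      also have "\<dots> = (\<integral>\<^sup>+\<omega>. ennreal (min (Y n \<omega>) c) \<partial>M) + (\<integral>\<^sup>+\<omega>. ennreal ((Y n \<omega>)\<^sup>2) \<partial>M) / ennreal c"
        by (simp add: nn_integral_add nn_integral_divide)
      also have "\<dots> \<le> ennreal (\<integral>\<omega>. min (Y n \<omega>) c \<partial>M) + ennreal C / ennreal c"
        using nonneg c
        by (intro add_mono divide_right_mono_ennreal second eq_refl[OF nn_integral_eq_integral] int) auto
      also have "\<dots> = ennreal ((\<integral>\<omega>. min (Y n \<omega>) c \<partial>M) + C / c)"
        using c C nonneg by (simp add: divide_ennreal)
      finally show ?thesis by (simp add: ennreal_1[symmetric] ennreal_le_iff2 del: ennreal_1) 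
    qed
    then have "1 \<le> (\<integral>\<omega>. min (Z \<omega>) c \<partial>M) + C / c"
      by (intro LIMSEQ_le_const[OF tendsto_add[OF lim_min tendsto_const]]) auto
    moreover have "ennreal (\<integral>\<omega>. min (Z \<omega>) c \<partial>M) \<le> ennreal r"
    proof -
      have "ennreal (\<integral>\<omega>. min (Z \<omega>) c \<partial>M) = (\<integral>\<^sup>+\<omega>. ennreal (min (Z \<omega>) c) \<partial>M)"
        using Z_nonneg c
        by (intro nn_integral_eq_integral[symmetric] integrable_const_bound[of _ c] AE_I2)
           (auto simp: abs_of_nonneg min_def)
      also have "\<dots> \<le> (\<integral>\<^sup>+\<omega>. ennreal (Z \<omega>) \<partial>M)"
        by (intro nn_integral_mono ennreal_leI) auto
      finally show ?thesis using real by simp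
    qed
    ultimately show ?thesis using real by (simp add: c_def)
  qed
  have "(\<lambda>k. r + C / real (Suc k)) \<longlonglongrightarrow> r + 0"
    by (intro tendsto_intros LIMSEQ_Suc[OF lim_const_over_n])
  then have "1 \<le> r" using key LIMSEQ_le_const by fastforce
  then show ?thesis using real by (simp add: ennreal_1[symmetric] del: ennreal_1)
qed simp

text \<open>The starting point lies on or below the boundary and the horizon \<open>m\<close> is
  fixed; it tends to infinity only outside the locale.\<close>

locale brownian_boundary = prob_space N for N :: "'b measure" +
  fixes W :: "real \<Rightarrow> 'b \<Rightarrow> real" and t x \<alpha> :: real and m :: nat
  assumes bm: "standard_brownian_motion N W" and t: "t > 0"
    and \<alpha>: "0 < \<alpha>" "\<alpha> < 1" "(1 - \<alpha>\<^sup>2) * mills \<alpha> = \<alpha>"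
    and x: "x \<le> \<alpha> * sqrt t" and m: "m > 0"
begin

lemma W_meas[measurable]: "0 \<le> s \<Longrightarrow> W s \<in> borel_measurable N"
  and W_0: "\<omega> \<in> space N \<Longrightarrow> W 0 \<omega> = 0"
  and W_cont: "\<omega> \<in> space N \<Longrightarrow> continuous_on {0..} (\<lambda>s. W s \<omega>)"
  and W_indep: "0 \<le> u 0 \<Longrightarrow> strict_mono_on {..k} u \<Longrightarrow>
        indep_vars (\<lambda>_. borel) (\<lambda>i \<omega>. W (u (Suc i)) \<omega> - W (u i) \<omega>) {..<k}"
  and W_distr: "0 \<le> r \<Longrightarrow> r < s \<Longrightarrow>
        distributed N lborel (\<lambda>\<omega>. W s \<omega> - W r \<omega>) (\<lambda>y. ennreal (normal_density 0 (sqrt (s - r)) y))"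
  using bm unfolding standard_brownian_motion_def by blast+

section \<open>First crossing of the boundary on a dyadic grid\<close>

definition crossed :: "nat \<Rightarrow> nat \<Rightarrow> 'b \<Rightarrow> bool" where
  "crossed n k \<omega> \<longleftrightarrow> \<alpha> * sqrt (t + real k / 2 ^ n) \<le> x + W (real k / 2 ^ n) \<omega>"

text \<open>The alternative \<open>k = m * 2 ^ n\<close> is the horizon in grid units: it truncates
  the time at \<open>m\<close> and guarantees that the least element exists.\<close>

definition hit :: "nat \<Rightarrow> 'b \<Rightarrow> nat" where
  "hit n \<omega> = (LEAST k. k = m * 2 ^ n \<or> crossed n k \<omega>)"

definition hit_time :: "nat \<Rightarrow> 'b \<Rightarrow> real" where
  "hit_time n \<omega> = real (hit n \<omega>) / 2 ^ n"

lemma hit_le: "hit n \<omega> \<le> m * 2 ^ n"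
  unfolding hit_def by (rule Least_le) simp

lemma hit_cases: "hit n \<omega> = m * 2 ^ n \<or> crossed n (hit n \<omega>) \<omega>"
  unfolding hit_def by (rule LeastI[of _ "m * 2 ^ n"]) simp

lemma not_crossed: "k < hit n \<omega> \<Longrightarrow> \<not> crossed n k \<omega>"
  unfolding hit_def using not_less_Least by blast

lemma hit_le_iff: "k < m * 2 ^ n \<Longrightarrow> hit n \<omega> \<le> k \<longleftrightarrow> (\<exists>j\<le>k. crossed n j \<omega>)"
  using hit_cases[of n \<omega>] not_crossed[of _ n \<omega>] by (metis leD leI le_trans)

lemma hit_time_nonneg: "0 \<le> hit_time n \<omega>"
  by (simp add: hit_time_def)

lemma hit_time_le: "hit_time n \<omega> \<le> m"
proof -
  have "real (hit n \<omega>) \<le> real (m * 2 ^ n)" using hit_le by (simp only: of_nat_le_iff)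
  then show ?thesis by (simp add: hit_time_def divide_le_eq)
qed

text \<open>The grid point with index \<open>k\<close> on level \<open>n\<close> has index
  \<open>2 * k\<close> on level \<open>Suc n\<close>, so every crossing seen on the coarse grid is
  seen on the finer one.\<close>

lemma hit_time_decseq: "decseq (\<lambda>n. hit_time n \<omega>)"
proof (rule decseq_SucI)
  fix n
  have "hit (Suc n) \<omega> \<le> 2 * hit n \<omega>"
  proof (cases "hit n \<omega> = m * 2 ^ n")
    case True
    then show ?thesis using hit_le[of "Suc n" \<omega>] by simp
  next
    case False
    then have "crossed n (hit n \<omega>) \<omega>" using hit_cases by blast
    then have "crossed (Suc n) (2 * hit n \<omega>) \<omega>" by (simp add: crossed_def)
    then show ?thesis unfolding hit_def[of "Suc n"] by (intro Least_le) simp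
  qed
  then have "real (hit (Suc n) \<omega>) \<le> 2 * real (hit n \<omega>)" by linarith
  then show "hit_time (Suc n) \<omega> \<le> hit_time n \<omega>" by (simp add: hit_time_def divide_le_eq)
qed

lemma hit_meas[measurable]: "hit n \<in> measurable N (count_space UNIV)"
proof -
  have [measurable]: "Measurable.pred N (crossed n j)" for j
    unfolding crossed_def[abs_def] by measurable
  show ?thesis unfolding hit_def[abs_def] by measurable
qed

lemma hit_time_meas[measurable]: "hit_time n \<in> borel_measurable N"
  unfolding hit_time_def[abs_def] by measurable

lemma W_hit_time_meas[measurable]: "(\<lambda>\<omega>. W (hit_time n \<omega>) \<omega>) \<in> borel_measurable N"
  unfolding hit_time_def
  by (rule measurable_compose_countable[where f="\<lambda>k \<omega>. W (real k / 2 ^ n) \<omega>" and g="hit n"]) measurable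

text \<open>On a grid of mesh \<open>h\<close> the exponential is a product over independent
  Gaussian increments of variance \<open>h\<close>, each factor having mean exactly 1. Hence
  equality here, against an inequality for the walk.\<close>

lemma exponential_hit_time:
  "(\<integral>\<^sup>+\<omega>. ennreal (exp (l * W (hit_time n \<omega>) \<omega> - l\<^sup>2 * hit_time n \<omega> / 2)) \<partial>N) = 1"
proof -
  define h :: real where "h = 1 / 2 ^ n"
  have h: "h > 0" by (simp add: h_def)
  define D where "D i \<omega> = W (real (Suc i) / 2 ^ n) \<omega> - W (real i / 2 ^ n) \<omega>" for i \<omega>
  define f where "f y = exp (l * y - l\<^sup>2 * h / 2)" for y
  have W_eq: "W (real k / 2 ^ n) \<omega> = (\<Sum>i<k. D i \<omega>)" if "\<omega> \<in> space N" for k \<omega>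
    unfolding D_def by (subst sum_lessThan_telescope) (simp add: W_0[OF that])
  let ?K = "m * 2 ^ n"
  have "(\<integral>\<^sup>+\<omega>. ennreal (\<Prod>i<min (hit n \<omega>) ?K. f (D i \<omega>)) \<partial>N) = 1"
  proof (rule nn_integral_stopped_prod[where D=D and f=f and K="?K" and \<kappa>="hit n"])
    show "indep_vars (\<lambda>_. borel) D {..<?K}"
      unfolding D_def
      by (rule W_indep[where u="\<lambda>i. real i / 2 ^ n"]) (auto intro!: strict_mono_onI divide_strict_right_mono)
    show "f \<in> borel_measurable borel" unfolding f_def by measurable
    show "(\<integral>\<^sup>+\<omega>. ennreal (f (D i \<omega>)) \<partial>N) = 1" for i
    proof -
      have "distributed N lborel (D i) (\<lambda>y. ennreal (normal_density 0 (sqrt h) y))"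
        using W_distr[of "real i / 2 ^ n" "real (Suc i) / 2 ^ n"]
        by (simp add: D_def[abs_def] h_def divide_strict_right_mono diff_divide_distrib[symmetric])
      from nn_integral_exp_normal[OF _ this, of l] h show ?thesis by (simp add: f_def)
    qed
    fix k assume k: "k < ?K"
    let ?R = "\<lambda>\<omega>. \<lambda>i\<in>{..<k}. D i \<omega>"
    let ?P = "PiM {..<k} (\<lambda>_. borel :: real measure)"
    let ?V = "vimage_algebra (space N) ?R ?P"
    have R: "?R \<in> measurable ?V ?P"
      by (rule measurable_vimage_algebra1) (auto simp: space_PiM)
    have [measurable]: "(\<lambda>d. \<Sum>i<j. d i) \<in> borel_measurable ?P" if "j \<in> {..k}" for j
      using that by (intro borel_measurable_sum measurable_component_singleton) auto
    \<comment> \<open>A crossing at an index \<open>j \<le> k\<close> is expressed by the sum of the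
      increments below \<open>j\<close>, hence by the first \<open>k\<close> coordinates.\<close>
    have "Measurable.pred ?P (\<lambda>d. \<exists>j\<in>{..k}. \<alpha> * sqrt (t + real j / 2 ^ n) \<le> x + (\<Sum>i<j. d i))"
      by measurable
    from measurable_compose[OF R this]
    have "{\<omega> \<in> space N. \<exists>j\<in>{..k}. \<alpha> * sqrt (t + real j / 2 ^ n) \<le> x + (\<Sum>i<j. ?R \<omega> i)} \<in> sets ?V"
      by (simp add: pred_def)
    moreover have "{\<omega> \<in> space N. \<exists>j\<in>{..k}. \<alpha> * sqrt (t + real j / 2 ^ n) \<le> x + (\<Sum>i<j. ?R \<omega> i)}
        = {\<omega> \<in> space N. hit n \<omega> \<le> k}"
      unfolding hit_le_iff[OF k] crossed_def
      by (intro Collect_cong conj_cong refl) (auto simp: W_eq)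
    ultimately show "{\<omega> \<in> space N. hit n \<omega> \<le> k} \<in> sets ?V" by simp
  qed (auto simp: f_def)
  moreover have "(\<Prod>i<min (hit n \<omega>) ?K. f (D i \<omega>)) = exp (l * W (hit_time n \<omega>) \<omega> - l\<^sup>2 * hit_time n \<omega> / 2)"
    if "\<omega> \<in> space N" for \<omega>
  proof -
    have "(\<Prod>i<min (hit n \<omega>) ?K. f (D i \<omega>)) = exp (\<Sum>i<hit n \<omega>. l * D i \<omega> - l\<^sup>2 * h / 2)"
      using hit_le[of n \<omega>] by (simp add: f_def exp_sum min_absorb1)
    also have "(\<Sum>i<hit n \<omega>. l * D i \<omega> - l\<^sup>2 * h / 2) = l * W (hit_time n \<omega>) \<omega> - l\<^sup>2 * hit_time n \<omega> / 2"
      unfolding hit_time_def W_eq[OF that]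
      by (simp add: sum_subtractf sum_distrib_left h_def)
    finally show ?thesis .
  qed
  then have "(\<integral>\<^sup>+\<omega>. ennreal (\<Prod>i<min (hit n \<omega>) ?K. f (D i \<omega>)) \<partial>N)
      = (\<integral>\<^sup>+\<omega>. ennreal (exp (l * W (hit_time n \<omega>) \<omega> - l\<^sup>2 * hit_time n \<omega> / 2)) \<partial>N)"
    by (intro nn_integral_cong arg_cong[where f=ennreal])
  ultimately show ?thesis by argo
qed

text \<open>The square is the exponential with parameter \<open>2 * l\<close> times
  \<open>exp (l\<^sup>2 * hit_time n \<omega>)\<close>. The horizon bounds the latter uniformly in
  \<open>n\<close>, as passing to the limit in \<open>n\<close> requires.\<close>

lemma exponential_square_hit_time:
  "(\<integral>\<^sup>+\<omega>. ennreal ((exp (l * W (hit_time n \<omega>) \<omega> - l\<^sup>2 * hit_time n \<omega> / 2))\<^sup>2) \<partial>N) \<le> ennreal (exp (l\<^sup>2 * m))"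
proof -
  have "(\<integral>\<^sup>+\<omega>. ennreal ((exp (l * W (hit_time n \<omega>) \<omega> - l\<^sup>2 * hit_time n \<omega> / 2))\<^sup>2) \<partial>N)
    \<le> (\<integral>\<^sup>+\<omega>. ennreal (exp (l\<^sup>2 * m)) * ennreal (exp ((2 * l) * W (hit_time n \<omega>) \<omega> - (2 * l)\<^sup>2 * hit_time n \<omega> / 2)) \<partial>N)"
  proof (intro nn_integral_mono)
    fix \<omega>
    have "(exp (l * W (hit_time n \<omega>) \<omega> - l\<^sup>2 * hit_time n \<omega> / 2))\<^sup>2
        = exp (l\<^sup>2 * hit_time n \<omega>) * exp ((2 * l) * W (hit_time n \<omega>) \<omega> - (2 * l)\<^sup>2 * hit_time n \<omega> / 2)"
      unfolding exp_double[symmetric] mult_exp_exp by (simp add: power2_eq_square algebra_simps)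
    also have "\<dots> \<le> exp (l\<^sup>2 * m) * exp ((2 * l) * W (hit_time n \<omega>) \<omega> - (2 * l)\<^sup>2 * hit_time n \<omega> / 2)"
      by (intro mult_right_mono) (auto simp: hit_time_le mult_left_mono)
    finally show "ennreal ((exp (l * W (hit_time n \<omega>) \<omega> - l\<^sup>2 * hit_time n \<omega> / 2))\<^sup>2)
      \<le> ennreal (exp (l\<^sup>2 * m)) * ennreal (exp ((2 * l) * W (hit_time n \<omega>) \<omega> - (2 * l)\<^sup>2 * hit_time n \<omega> / 2))"
      by (simp add: ennreal_mult[symmetric] ennreal_leI)
  qed
  also have "\<dots> = ennreal (exp (l\<^sup>2 * m))"
    by (subst nn_integral_cmult) (measurable, simp only: exponential_hit_time mult_1_right)
  finally show ?thesis .
qed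

section \<open>The limit of the grid times\<close>

definition lim_time :: "'b \<Rightarrow> real" where
  "lim_time \<omega> = lim (\<lambda>n. hit_time n \<omega>)"

lemma hit_time_lim: "(\<lambda>n. hit_time n \<omega>) \<longlonglongrightarrow> lim_time \<omega>"
proof -
  have "convergent (\<lambda>n. hit_time n \<omega>)"
    using decseq_convergent[OF hit_time_decseq[of \<omega>], of 0] hit_time_nonneg by (metis convergentI)
  then show ?thesis unfolding lim_time_def by (simp add: convergent_LIMSEQ_iff)
qed

lemma lim_time_nonneg: "0 \<le> lim_time \<omega>"
  using LIMSEQ_le_const[OF hit_time_lim] hit_time_nonneg by blast

lemma W_hit_time_lim:
  assumes "\<omega> \<in> space N"
  shows "(\<lambda>n. W (hit_time n \<omega>) \<omega>) \<longlonglongrightarrow> W (lim_time \<omega>) \<omega>"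
  by (rule continuous_on_tendsto_compose[OF W_cont[OF assms] hit_time_lim])
     (auto simp: lim_time_nonneg hit_time_nonneg)

lemma lim_time_meas[measurable]: "lim_time \<in> borel_measurable N"
  by (rule borel_measurable_LIMSEQ_real[OF hit_time_lim]) measurable

lemma W_lim_time_meas[measurable]: "(\<lambda>\<omega>. W (lim_time \<omega>) \<omega>) \<in> borel_measurable N"
  by (rule borel_measurable_LIMSEQ_real[OF W_hit_time_lim]) measurable

text \<open>The grid point preceding a hitting time still lies below the boundary, and these points
  converge to the limit as well.\<close>

lemma lim_time_below_boundary:
  assumes \<omega>: "\<omega> \<in> space N"
  shows "x + W (lim_time \<omega>) \<omega> \<le> \<alpha> * sqrt (t + lim_time \<omega>)"
proof (cases "lim_time \<omega> = 0")
  \<comment> \<open>At time 0 there may be no preceding grid point; the assumption on the starting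
    point \<open>x\<close> takes its place.\<close>
  case True
  then show ?thesis using x by (simp add: W_0[OF \<omega>])
next
  case False
  then have pos: "lim_time \<omega> > 0" using lim_time_nonneg[of \<omega>] by simp
  define s where "s n = hit_time n \<omega> - 1 / 2 ^ n" for n
  have "lim_time \<omega> \<le> hit_time n \<omega>" for n
    by (rule decseq_ge[OF hit_time_decseq hit_time_lim])
  with pos have "hit_time n \<omega> > 0" for n by (meson less_le_trans)
  then have hit_pos: "hit n \<omega> > 0" for n
    by (simp add: hit_time_def zero_less_divide_iff)
  have s_eq: "s n = real (hit n \<omega> - 1) / 2 ^ n" for n
    using hit_pos[of n] by (simp add: s_def hit_time_def diff_divide_distrib of_nat_diff Suc_leI)
  have below: "x + W (s n) \<omega> \<le> \<alpha> * sqrt (t + s n)" for n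
    using not_crossed[of "hit n \<omega> - 1" n \<omega>] hit_pos[of n] by (simp add: crossed_def s_eq)
  have "(\<lambda>n. 1 / 2 ^ n :: real) \<longlonglongrightarrow> 0" by real_asymp
  from tendsto_diff[OF hit_time_lim this] have s_lim: "s \<longlonglongrightarrow> lim_time \<omega>"
    by (simp add: s_def[abs_def])
  have W_lim: "(\<lambda>n. W (s n) \<omega>) \<longlonglongrightarrow> W (lim_time \<omega>) \<omega>"
    by (rule continuous_on_tendsto_compose[OF W_cont[OF \<omega>] s_lim])
       (auto simp: lim_time_nonneg s_eq)
  show ?thesis
    by (rule LIMSEQ_le[of "\<lambda>n. x + W (s n) \<omega>" _ "\<lambda>n. \<alpha> * sqrt (t + s n)"])
       (auto intro!: tendsto_intros W_lim s_lim below)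
qed

lemma exponential_lim_time:
  "1 \<le> (\<integral>\<^sup>+\<omega>. ennreal (exp (l * W (lim_time \<omega>) \<omega> - l\<^sup>2 * lim_time \<omega> / 2)) \<partial>N)"
proof (rule nn_integral_limit_ge_1)
  show "(\<integral>\<^sup>+\<omega>. ennreal (exp (l * W (hit_time n \<omega>) \<omega> - l\<^sup>2 * hit_time n \<omega> / 2)) \<partial>N) = 1" for n
    by (rule exponential_hit_time)
  show "(\<integral>\<^sup>+\<omega>. ennreal ((exp (l * W (hit_time n \<omega>) \<omega> - l\<^sup>2 * hit_time n \<omega> / 2))\<^sup>2) \<partial>N) \<le> ennreal (exp (l\<^sup>2 * m))" for n
    by (rule exponential_square_hit_time)
  show "(\<lambda>n. exp (l * W (hit_time n \<omega>) \<omega> - l\<^sup>2 * hit_time n \<omega> / 2))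
      \<longlonglongrightarrow> exp (l * W (lim_time \<omega>) \<omega> - l\<^sup>2 * lim_time \<omega> / 2)" if "\<omega> \<in> space N" for \<omega>
    by (intro tendsto_intros W_hit_time_lim[OF that] hit_time_lim) auto
qed auto

text \<open>Mixing the bounds \<open>exponential_lim_time\<close> over \<open>l\<close> shows that
  the mean of \<phi> at \<open>lim_time\<close> is at least its starting value. The path is then on
  or below the boundary, where monotonicity of \<open>mills\<close> bounds \<phi> by its boundary
  value.\<close>

lemma mills_le_expectation_lim_time:
  "(1 - \<alpha>\<^sup>2) * (mills (x / sqrt t) / sqrt t) \<le> (\<integral>\<omega>. \<alpha> / sqrt (t + lim_time \<omega>) \<partial>N)"
proof -
  have c: "0 \<le> 1 - \<alpha>\<^sup>2" using \<alpha> by (simp add: power_le_one)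
  have [measurable]: "(\<lambda>\<omega>. expint (t + lim_time \<omega>) (x + W (lim_time \<omega>) \<omega>)) \<in> borel_measurable N"
    unfolding expint_def by measurable
  have "expint t x = (\<integral>\<^sup>+l\<in>{0..}. ennreal (exp (l * x - l\<^sup>2 * t / 2)) * 1 \<partial>lborel)"
    by (simp add: expint_def)
  also have "\<dots> \<le> (\<integral>\<^sup>+l\<in>{0..}. ennreal (exp (l * x - l\<^sup>2 * t / 2)) *
      (\<integral>\<^sup>+\<omega>. ennreal (exp (l * W (lim_time \<omega>) \<omega> - l\<^sup>2 * lim_time \<omega> / 2)) \<partial>N) \<partial>lborel)"
    by (intro nn_integral_mono mult_right_mono mult_left_mono exponential_lim_time) auto
  also have "\<dots> = (\<integral>\<^sup>+\<omega>. expint (t + lim_time \<omega>) (x + W (lim_time \<omega>) \<omega>) \<partial>N)"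
    by (rule nn_integral_expint[symmetric]) measurable
  finally have "ennreal (1 - \<alpha>\<^sup>2) * expint t x
      \<le> ennreal (1 - \<alpha>\<^sup>2) * (\<integral>\<^sup>+\<omega>. expint (t + lim_time \<omega>) (x + W (lim_time \<omega>) \<omega>) \<partial>N)"
    by (rule mult_left_mono) simp
  also have "\<dots> = (\<integral>\<^sup>+\<omega>. ennreal (1 - \<alpha>\<^sup>2) * expint (t + lim_time \<omega>) (x + W (lim_time \<omega>) \<omega>) \<partial>N)"
    by (rule nn_integral_cmult[symmetric]) measurable
  also have "\<dots> \<le> (\<integral>\<^sup>+\<omega>. ennreal (\<alpha> / sqrt (t + lim_time \<omega>)) \<partial>N)"
  proof (intro nn_integral_mono)
    fix \<omega> assume \<omega>: "\<omega> \<in> space N"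
    let ?s = "t + lim_time \<omega>" and ?y = "x + W (lim_time \<omega>) \<omega>"
    have s: "?s > 0" using t lim_time_nonneg[of \<omega>] by simp
    have "?y / sqrt ?s \<le> \<alpha>"
      using lim_time_below_boundary[OF \<omega>] s by (simp add: divide_le_eq)
    then have "(1 - \<alpha>\<^sup>2) * mills (?y / sqrt ?s) \<le> \<alpha>"
      using mult_left_mono[OF mills_mono c] \<alpha>(3) by metis
    then have "(1 - \<alpha>\<^sup>2) * mills (?y / sqrt ?s) / sqrt ?s \<le> \<alpha> / sqrt ?s"
      using s by (intro divide_right_mono) auto
    then show "ennreal (1 - \<alpha>\<^sup>2) * expint ?s ?y \<le> ennreal (\<alpha> / sqrt ?s)"
      using c s mills_pos[of "?y / sqrt ?s"]
      by (simp add: expint_eq_mills ennreal_mult[symmetric] ennreal_leI)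
  qed
  also have "\<dots> = ennreal (\<integral>\<omega>. \<alpha> / sqrt (t + lim_time \<omega>) \<partial>N)"
  proof (intro nn_integral_eq_integral integrable_const_bound[of _ "\<alpha> / sqrt t"] AE_I2)
    show "norm (\<alpha> / sqrt (t + lim_time \<omega>)) \<le> \<alpha> / sqrt t" for \<omega>
      using \<alpha> t lim_time_nonneg[of \<omega>] by (auto intro!: divide_left_mono simp: abs_of_nonneg)
    show "0 \<le> \<alpha> / sqrt (t + lim_time \<omega>)" for \<omega>
      using \<alpha> t lim_time_nonneg[of \<omega>] by simp
  qed measurable
  finally have "ennreal ((1 - \<alpha>\<^sup>2) * (mills (x / sqrt t) / sqrt t)) \<le> ennreal (\<integral>\<omega>. \<alpha> / sqrt (t + lim_time \<omega>) \<partial>N)"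
    using t c mills_pos[of "x / sqrt t"] by (simp add: expint_eq_mills ennreal_mult[symmetric])
  then show ?thesis
  proof (subst (asm) ennreal_le_iff)
    show "0 \<le> (\<integral>\<omega>. \<alpha> / sqrt (t + lim_time \<omega>) \<partial>N)"
      using \<alpha> t lim_time_nonneg by (intro integral_nonneg_AE AE_I2) (simp add: add_pos_nonneg less_imp_le)
  qed auto
qed

text \<open>From the horizon on the event is everything. Before it, the event says that some grid
  time up to \<open>u\<close> is a crossing, a countable union of events known at time
  \<open>u\<close>.\<close>

lemma stopping_time_hit_time:
  "stopping_time (natural_filtration N {0..} ennreal W) (\<lambda>\<omega>. ennreal (hit_time n \<omega>))"
proof
  fix u :: ennreal
  let ?F = "natural_filtration N {0..} ennreal W u"
  have space_F: "space ?F = space N"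
    by (rule filtration.space_F[OF filtration_natural_filtration])
  show "Measurable.pred ?F (\<lambda>\<omega>. ennreal (hit_time n \<omega>) \<le> u)"
  proof (cases "ennreal m \<le> u")
    case True
    then have "ennreal (hit_time n \<omega>) \<le> u" for \<omega>
      using ennreal_leI[OF hit_time_le[of n \<omega>]] by (rule order_trans[rotated])
    then show ?thesis by simp
  next
    case False
    have W_F: "W s \<in> borel_measurable ?F" if "0 \<le> s" "ennreal s \<le> u" for s
    proof (rule measurableI)
      fix A :: "real set" assume "A \<in> sets borel"
      then show "W s -` A \<inter> space ?F \<in> sets ?F"
        unfolding space_F unfolding natural_filtration_def
        by (subst sets_measure_of) (use that in auto)
    qed simp
    have iff: "ennreal (hit_time n \<omega>) \<le> u \<longleftrightarrow> (\<exists>k\<in>{k. ennreal (real k / 2 ^ n) \<le> u}. crossed n k \<omega>)" for \<omega>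
    proof
      assume le: "ennreal (hit_time n \<omega>) \<le> u"
      have "hit n \<omega> \<noteq> m * 2 ^ n"
        using le False by (auto simp: hit_time_def)
      then show "\<exists>k\<in>{k. ennreal (real k / 2 ^ n) \<le> u}. crossed n k \<omega>"
        using hit_cases[of n \<omega>] le unfolding hit_time_def by blast
    next
      assume "\<exists>k\<in>{k. ennreal (real k / 2 ^ n) \<le> u}. crossed n k \<omega>"
      then obtain k where k: "ennreal (real k / 2 ^ n) \<le> u" "crossed n k \<omega>" by blast
      then have "hit n \<omega> \<le> k" unfolding hit_def by (intro Least_le) simp
      then have "hit_time n \<omega> \<le> real k / 2 ^ n" by (simp add: hit_time_def divide_right_mono)
      then show "ennreal (hit_time n \<omega>) \<le> u" using k(1) ennreal_leI order_trans by blast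
    qed
    have "Measurable.pred ?F (crossed n k)" if "k \<in> {k. ennreal (real k / 2 ^ n) \<le> u}" for k
    proof -
      have [measurable]: "W (real k / 2 ^ n) \<in> borel_measurable ?F" using that by (intro W_F) auto
      show ?thesis unfolding crossed_def[abs_def] by measurable
    qed
    then show ?thesis unfolding iff by (intro pred_intros_countable_bounded) auto
  qed
qed

section \<open>Moments of Brownian motion and the payoff at the grid times\<close>

lemma W_moments:
  assumes s: "0 < s"
  shows "integrable N (W s)" "integrable N (\<lambda>\<omega>. (W s \<omega>)\<^sup>2)" "(\<integral>\<omega>. (W s \<omega>)\<^sup>2 \<partial>N) = s"
proof -
  let ?Z = "\<lambda>\<omega>. W s \<omega> - W 0 \<omega>"
  have Z: "distributed N lborel ?Z (\<lambda>y. ennreal (normal_density 0 (sqrt s) y))"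
    using W_distr[of 0 s] s by simp
  have sq: "0 < sqrt s" using s by simp
  have eq: "?Z \<omega> = W s \<omega>" if "\<omega> \<in> space N" for \<omega>
    using W_0[OF that] by simp
  have "integrable N (\<lambda>\<omega>. ?Z \<omega> ^ k)" for k
    using distributed_integrable[OF Z, of "\<lambda>y. y ^ k"] integrable_normal_moment[OF sq, of 0 k] by simp
  from this[of 1] this[of 2] show "integrable N (W s)" "integrable N (\<lambda>\<omega>. (W s \<omega>)\<^sup>2)"
    by (simp_all add: eq cong: Bochner_Integration.integrable_cong)
  have "expectation ?Z = 0" by (rule normal_distributed_expectation[OF sq Z])
  with normal_distributed_variance[OF sq Z] have "(\<integral>\<omega>. (?Z \<omega>)\<^sup>2 \<partial>N) = s"
    using s by simp
  then show "(\<integral>\<omega>. (W s \<omega>)\<^sup>2 \<partial>N) = s"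
    by (simp add: eq cong: Bochner_Integration.integral_cong)
qed

text \<open>Expand \<open>0 \<le> (\<bar>W s \<omega>\<bar> - sqrt s)\<^sup>2\<close>, divide by
  \<open>2 * sqrt s\<close> and take expectations, using that the second moment is
  \<open>s\<close>.\<close>

lemma expectation_abs_W_le:
  assumes s: "0 < s"
  shows "(\<integral>\<omega>. \<bar>W s \<omega>\<bar> \<partial>N) \<le> sqrt s"
proof -
  note [simp] = W_moments[OF s]
  have half: "s / (2 * sqrt s) = sqrt s / 2"
    using s by (simp add: real_div_sqrt field_simps)
  have "(\<integral>\<omega>. \<bar>W s \<omega>\<bar> \<partial>N) \<le> (\<integral>\<omega>. (W s \<omega>)\<^sup>2 / (2 * sqrt s) + sqrt s / 2 \<partial>N)"
  proof (rule integral_mono)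
    fix \<omega>
    have "0 \<le> (\<bar>W s \<omega>\<bar> - sqrt s)\<^sup>2" by simp
    then have "2 * sqrt s * \<bar>W s \<omega>\<bar> \<le> (W s \<omega>)\<^sup>2 + (sqrt s)\<^sup>2"
      by (simp add: power2_diff algebra_simps del: real_sqrt_pow2)
    then have "(2 * sqrt s * \<bar>W s \<omega>\<bar>) / (2 * sqrt s) \<le> ((W s \<omega>)\<^sup>2 + (sqrt s)\<^sup>2) / (2 * sqrt s)"
      using s by (intro divide_right_mono) auto
    then show "\<bar>W s \<omega>\<bar> \<le> (W s \<omega>)\<^sup>2 / (2 * sqrt s) + sqrt s / 2"
      using s half by (simp add: add_divide_distrib)
  qed auto
  also have "\<dots> = s / (2 * sqrt s) + sqrt s / 2"
    by (simp add: prob_space)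
  also note half
  finally show ?thesis by simp
qed

text \<open>Only finitely many grid values of the path can occur, so the sum of their absolute
  values dominates. This rules out the default value 0 of the integral.\<close>

lemma payoff_integrable:
  "integrable N (\<lambda>\<omega>. (x + W (hit_time n \<omega>) \<omega>) / (t + hit_time n \<omega>))"
proof (rule Bochner_Integration.integrable_bound)
  let ?B = "\<lambda>\<omega>. (\<bar>x\<bar> + (\<Sum>k\<le>m * 2 ^ n. \<bar>W (real k / 2 ^ n) \<omega>\<bar>)) / t"
  have int: "integrable N (W (real k / 2 ^ n))" for k
  proof (cases "k = 0")
    case True
    then show ?thesis by (simp add: W_0 cong: Bochner_Integration.integrable_cong)
  qed (auto intro!: W_moments(1))
  then show "integrable N ?B"
    by (intro integrable_divide Bochner_Integration.integrable_add Bochner_Integration.integrable_sum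
        integrable_abs) auto
  show "AE \<omega> in N. norm ((x + W (hit_time n \<omega>) \<omega>) / (t + hit_time n \<omega>)) \<le> norm (?B \<omega>)"
  proof (intro AE_I2)
    fix \<omega>
    have "\<bar>W (hit_time n \<omega>) \<omega>\<bar> \<le> (\<Sum>k\<le>m * 2 ^ n. \<bar>W (real k / 2 ^ n) \<omega>\<bar>)"
      unfolding hit_time_def
      by (rule member_le_sum[where f="\<lambda>k. \<bar>W (real k / 2 ^ n) \<omega>\<bar>"]) (auto simp: hit_le)
    then have "\<bar>x + W (hit_time n \<omega>) \<omega>\<bar> \<le> \<bar>x\<bar> + (\<Sum>k\<le>m * 2 ^ n. \<bar>W (real k / 2 ^ n) \<omega>\<bar>)" by linarith
    then have "\<bar>x + W (hit_time n \<omega>) \<omega>\<bar> / (t + hit_time n \<omega>) \<le> ?B \<omega>"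
      using t hit_time_nonneg[of n \<omega>] by (intro frac_le) auto
    then show "norm ((x + W (hit_time n \<omega>) \<omega>) / (t + hit_time n \<omega>)) \<le> norm (?B \<omega>)"
      using t hit_time_nonneg[of n \<omega>] by (simp add: abs_divide)
  qed
qed measurable

text \<open>A path that crosses before the horizon earns at least the boundary payoff. At the
  horizon it loses at most \<open>(\<bar>x\<bar> + \<bar>W m \<omega>\<bar>) / (t + m)\<close>, and
  the mean of \<open>\<bar>W m \<omega>\<bar>\<close> is at most \<open>sqrt m\<close>.\<close>

lemma V_brownian_ge_hit_time:
  "ereal ((\<integral>\<omega>. \<alpha> / sqrt (t + hit_time n \<omega>) \<partial>N)
     - (\<alpha> / sqrt (t + m) + (\<bar>x\<bar> + sqrt m) / (t + m))) \<le> V_brownian N W t x"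
proof -
  let ?p = "\<lambda>\<omega>. (x + W (hit_time n \<omega>) \<omega>) / (t + hit_time n \<omega>)"
  let ?b = "\<lambda>\<omega>. \<alpha> / sqrt (t + hit_time n \<omega>)"
  have m': "0 < real m" using m by simp
  have int_b: "integrable N ?b"
  proof (intro integrable_const_bound[of _ "\<alpha> / sqrt t"] AE_I2)
    show "norm (?b \<omega>) \<le> \<alpha> / sqrt t" for \<omega>
      using \<alpha> t hit_time_nonneg[of n \<omega>] by (auto intro!: divide_left_mono simp: abs_of_nonneg)
  qed measurable
  note int = int_b W_moments(1)[OF m']
  have "(\<integral>\<omega>. ?b \<omega> \<partial>N) - (\<alpha> / sqrt (t + m) + (\<bar>x\<bar> + sqrt m) / (t + m))
      \<le> (\<integral>\<omega>. ?b \<omega> \<partial>N) - (\<alpha> / sqrt (t + m) + (\<bar>x\<bar> + (\<integral>\<omega>. \<bar>W m \<omega>\<bar> \<partial>N)) / (t + m))"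
    using expectation_abs_W_le[OF m'] t by (intro diff_left_mono add_left_mono divide_right_mono) auto
  also have "\<dots> = (\<integral>\<omega>. ?b \<omega> - (\<alpha> / sqrt (t + m) + (\<bar>x\<bar> + \<bar>W m \<omega>\<bar>) / (t + m)) \<partial>N)"
    using int by (simp add: prob_space)
  also have "\<dots> \<le> (\<integral>\<omega>. ?p \<omega> \<partial>N)"
  proof (rule integral_mono[OF _ payoff_integrable])
    show "integrable N (\<lambda>\<omega>. ?b \<omega> - (\<alpha> / sqrt (t + m) + (\<bar>x\<bar> + \<bar>W m \<omega>\<bar>) / (t + m)))"
      using int by simp
    fix \<omega>
    show "?b \<omega> - (\<alpha> / sqrt (t + m) + (\<bar>x\<bar> + \<bar>W m \<omega>\<bar>) / (t + m)) \<le> ?p \<omega>"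
    proof (cases "hit n \<omega> = m * 2 ^ n")
      case True
      \<comment> \<open>Here the boundary payoff is \<open>\<alpha> / sqrt (t + m)\<close> and
        cancels against the first error term.\<close>
      then have *: "hit_time n \<omega> = m" by (simp add: hit_time_def)
      have "- ((\<bar>x\<bar> + \<bar>W m \<omega>\<bar>) / (t + m)) = (- \<bar>x\<bar> - \<bar>W m \<omega>\<bar>) / (t + m)"
        by (simp add: minus_divide_left)
      also have "\<dots> \<le> (x + W m \<omega>) / (t + m)"
        using t by (intro divide_right_mono) auto
      finally show ?thesis unfolding * by simp
    next
      case False
      let ?s = "t + hit_time n \<omega>"
      have s: "0 < ?s" using t hit_time_nonneg[of n \<omega>] by simp
      have "crossed n (hit n \<omega>) \<omega>" using False hit_cases by blast
      then have "\<alpha> * sqrt ?s \<le> x + W (hit_time n \<omega>) \<omega>" by (simp add: crossed_def hit_time_def)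
      then have "\<alpha> * sqrt ?s / ?s \<le> ?p \<omega>" using s by (intro divide_right_mono) auto
      moreover have "\<alpha> * sqrt ?s / ?s = ?b \<omega>" using s by (simp add: field_simps)
      moreover have "0 \<le> \<alpha> / sqrt (t + m) + (\<bar>x\<bar> + \<bar>W m \<omega>\<bar>) / (t + m)"
        using \<alpha> t by simp
      ultimately show ?thesis by linarith
    qed
  qed
  also have "ereal (\<integral>\<omega>. ?p \<omega> \<partial>N) \<le> V_brownian N W t x"
    unfolding V_brownian_def
    by (rule SUP_upper2[of "\<lambda>\<omega>. ennreal (hit_time n \<omega>)"])
       (simp_all add: stopping_time_hit_time hit_time_nonneg)
  finally show ?thesis by simp
qed

text \<open>The grid is refined with the horizon fixed; \<open>\<alpha> / sqrt t\<close> dominates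
  the boundary payoffs. The competing strategies are the \<open>hit_time n\<close>, with
  \<open>lim_time\<close> entering through the limit of their lower bounds.\<close>

lemma V_brownian_ge_mills_error:
  "ereal ((1 - \<alpha>\<^sup>2) * (mills (x / sqrt t) / sqrt t)
     - (\<alpha> / sqrt (t + m) + (\<bar>x\<bar> + sqrt m) / (t + m))) \<le> V_brownian N W t x"
proof -
  let ?e = "\<alpha> / sqrt (t + m) + (\<bar>x\<bar> + sqrt m) / (t + m)"
  have "(\<lambda>n. \<integral>\<omega>. \<alpha> / sqrt (t + hit_time n \<omega>) \<partial>N) \<longlonglongrightarrow> (\<integral>\<omega>. \<alpha> / sqrt (t + lim_time \<omega>) \<partial>N)"
  proof (rule integral_dominated_convergence[where w="\<lambda>_. \<alpha> / sqrt t"])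
    show "AE \<omega> in N. (\<lambda>n. \<alpha> / sqrt (t + hit_time n \<omega>)) \<longlonglongrightarrow> \<alpha> / sqrt (t + lim_time \<omega>)"
    proof (intro AE_I2 tendsto_intros hit_time_lim)
      show "sqrt (t + lim_time \<omega>) \<noteq> 0" for \<omega>
        using t lim_time_nonneg[of \<omega>] by simp
    qed
    show "AE \<omega> in N. norm (\<alpha> / sqrt (t + hit_time n \<omega>)) \<le> \<alpha> / sqrt t" for n
      using \<alpha> t hit_time_nonneg[of n]
      by (intro AE_I2) (auto intro!: divide_left_mono simp: abs_of_nonneg add_pos_nonneg)
  qed measurable
  then have "(\<lambda>n. ereal ((\<integral>\<omega>. \<alpha> / sqrt (t + hit_time n \<omega>) \<partial>N) - ?e))
      \<longlonglongrightarrow> ereal ((\<integral>\<omega>. \<alpha> / sqrt (t + lim_time \<omega>) \<partial>N) - ?e)"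
    by (intro tendsto_intros) 
  then have "ereal ((\<integral>\<omega>. \<alpha> / sqrt (t + lim_time \<omega>) \<partial>N) - ?e) \<le> V_brownian N W t x"
    by (rule LIMSEQ_le_const2) (use V_brownian_ge_hit_time in blast)
  moreover have "ereal ((1 - \<alpha>\<^sup>2) * (mills (x / sqrt t) / sqrt t) - ?e)
      \<le> ereal ((\<integral>\<omega>. \<alpha> / sqrt (t + lim_time \<omega>) \<partial>N) - ?e)"
    using mills_le_expectation_lim_time by simp
  ultimately show ?thesis by (rule order_trans[rotated])
qed

end

section \<open>Immediate stopping, infinite horizon and the comparison\<close>

lemma V_brownian_ge_immediate:
  assumes "standard_brownian_motion N W"
  shows "ereal (x / t) \<le> V_brownian N W t x"
proof -
  interpret prob_space N using assms by (simp add: standard_brownian_motion_def)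
  have "(\<integral>\<omega>. (x + W (enn2real 0) \<omega>) / (t + enn2real 0) \<partial>N) = (\<integral>\<omega>. x / t \<partial>N)"
    using assms by (intro Bochner_Integration.integral_cong) (auto simp: standard_brownian_motion_def)
  then have "(\<integral>\<omega>. (x + W (enn2real 0) \<omega>) / (t + enn2real 0) \<partial>N) = x / t"
    by (simp add: prob_space)
  then show ?thesis
    unfolding V_brownian_def
    by (intro SUP_upper2[of "\<lambda>\<omega>. 0"]) (auto simp: stopping_time_const)
qed

text \<open>The error term is of order \<open>1 / sqrt m\<close> and vanishes as the horizon tends
  to infinity.\<close>

lemma V_brownian_ge_mills:
  assumes bm: "standard_brownian_motion N W" and t: "t > 0"
    and \<alpha>: "0 < \<alpha>" "\<alpha> < 1" "(1 - \<alpha>\<^sup>2) * mills \<alpha> = \<alpha>" and x: "x \<le> \<alpha> * sqrt t"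
  shows "ereal ((1 - \<alpha>\<^sup>2) * (mills (x / sqrt t) / sqrt t)) \<le> V_brownian N W t x"
proof -
  let ?v = "(1 - \<alpha>\<^sup>2) * (mills (x / sqrt t) / sqrt t)"
  let ?e = "\<lambda>m::nat. \<alpha> / sqrt (t + m) + (\<bar>x\<bar> + sqrt m) / (t + m)"
  have le: "ereal (?v - ?e m) \<le> V_brownian N W t x" if "m > 0" for m
  proof -
    interpret brownian_boundary N W t x \<alpha> m
      using assms that
      by (simp add: brownian_boundary_def brownian_boundary_axioms_def standard_brownian_motion_def)
    show ?thesis by (rule V_brownian_ge_mills_error)
  qed
  have "(\<lambda>m::nat. \<alpha> * (1 / sqrt (t + m)) + (\<bar>x\<bar> * (1 / (t + m)) + sqrt m / (t + m))) \<longlonglongrightarrow> \<alpha> * 0 + (\<bar>x\<bar> * 0 + 0)"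
    by (intro tendsto_add tendsto_mult tendsto_const) real_asymp+
  then have "?e \<longlonglongrightarrow> 0" by (simp add: add_divide_distrib)
  then have "(\<lambda>m. ereal (?v - ?e m)) \<longlonglongrightarrow> ereal (?v - 0)"
    by (intro tendsto_intros)
  then have "ereal (?v - 0) \<le> V_brownian N W t x"
    by (rule LIMSEQ_le_const2) (use le in \<open>auto intro!: exI[of _ 1]\<close>)
  then show ?thesis by simp
qed

theorem theorem1:
  fixes M :: "'a measure" and X :: "nat \<Rightarrow> 'a \<Rightarrow> real"
    and N :: "'b measure" and W :: "real \<Rightarrow> 'b \<Rightarrow> real"
    and t x :: real
  assumes "standard_brownian_motion N W"
    and "prob_space M"
    and "prob_space.indep_vars M (\<lambda>_. borel) X {1..}"
    and "\<And>i. i \<ge> 1 \<Longrightarrow> distr M borel (X i) = distr M borel (X 1)"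
    and "\<And>i. i \<ge> 1 \<Longrightarrow> subgaussian1 M (X i)"
    and "t > 0"
  shows "V_brownian N W t x \<ge> V_walk M (partial_sum X) t x"
proof -
  interpret M: prob_space M by fact
  obtain \<alpha> where \<alpha>: "0 < \<alpha>" "\<alpha> < 1" "(1 - \<alpha>\<^sup>2) * mills \<alpha> = \<alpha>"
    by (rule ex_shepp_constant)
  show ?thesis
  proof (cases "x \<le> \<alpha> * sqrt t")
    case True
    show ?thesis
      by (rule order_trans[OF M.V_walk_le_mills[OF assms(3-6) \<alpha>]
          V_brownian_ge_mills[OF assms(1,6) \<alpha> True]])
  next
    case False
    then have above: "\<alpha> * sqrt t \<le> x" by simp
    show ?thesis
      by (rule order_trans[OF M.V_walk_le_above_boundary[OF assms(3-6) \<alpha> above]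
          V_brownian_ge_immediate[OF assms(1)]])
  qed
qed

end
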